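(* Let $h>0$ and let $c(h),m(h)\in(0,\infty)$ be the constants of the lattice bound $\langle \sigma_x;\sigma_y\rangle_{a,h}\leq c(h)a^{1/4}|x-y|^{-1/4}e^{-m(h)|x-y|}$ valid for all $a\in(0,1]$ and $x\ne y\in a\mathbb{Z}^2$ (so that $m(h)\geq B_0h^{8/15}$ when $ha^{15/8}\le 1$). Then for all $f,g\in C_0^\infty(\mathbb{R}^2)$, \[\big|\mathrm{Cov}\big(\Phi^h(f),\Phi^h(g)\big)\big|\leq c(h)\int\!\!\int_{\mathbb{R}^2\times\mathbb{R}^2}|f(x)||g(y)|\,|x-y|^{-1/4}e^{-m(h)|x-y|}\,dx\,dy.\]
   Context: Let $\beta_c=\frac12\log(1+\sqrt2)$, and for $a>0,h\ge0$ let $P^a_h$ be the infinite-volume Ising measure on $a\mathbb{Z}^2$ at inverse temperature $\beta_c$ with external field $a^{15/8}h$, with expectation $\langle\cdot\rangle_{a,h}$ and truncated two-point function $\langle\sigma_x;\sigma_y\rangle_{a,h}$. The lattice magnetization field is $\Phi^{a,h}:=a^{15/8}\sum_{x\in a\mathbb{Z}^2}\sigma_x\delta_x$ with $\sigma\sim P^a_h$, so $\Phi^{a,h}(f)=a^{15/8}\sum_x\sigma_xf(x)$. It is known that $\Phi^{a,h}$ converges in law as $a\downarrow 0$ to a generalized random field $\Phi^h$ on $\mathbb{R}^2$ (the near-critical scaling limit magnetization field); $\Phi^h(f)$ denotes the field paired with a test function $f$. $C_0^\infty(\mathbb{R}^2)$ is the set of smooth compactly supported functions. *)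

theory Defs
  imports "HOL-Probability.Probability"
begin

definition beta_c :: real where
  "beta_c = ln (1 + sqrt 2) / 2"

definition box :: "nat \<Rightarrow> (int \<times> int) set" where
  "box n = {- int n .. int n} \<times> {- int n .. int n}"

definition spin_configs :: "(int \<times> int) set \<Rightarrow> (int \<times> int \<Rightarrow> real) set" where
  "spin_configs \<Lambda> = PiE \<Lambda> (\<lambda>_. {-1, 1})"

text \<open>Finite-volume (free boundary) Ising weight at inverse temperature beta_c and
  external field H (in lattice units):  exp(beta_c sum over nearest-neighbour
  bonds of eta_x eta_y + H sum_x eta_x).\<close>
definition ising_weight :: "real \<Rightarrow> (int \<times> int) set \<Rightarrow> (int \<times> int \<Rightarrow> real) \<Rightarrow> real" where
  "ising_weight H \<Lambda> \<eta> =
     exp (beta_c * (\<Sum>x\<in>\<Lambda>. \<Sum>y\<in>{(fst x + 1, snd x), (fst x, snd x + 1)} \<inter> \<Lambda>. \<eta> x * \<eta> y)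
          + H * (\<Sum>x\<in>\<Lambda>. \<eta> x))"

definition fv_prob :: "real \<Rightarrow> nat \<Rightarrow> (int \<times> int) set \<Rightarrow> (int \<times> int \<Rightarrow> real) \<Rightarrow> real" where
  "fv_prob H n S \<xi> =
     (\<Sum>\<eta>\<in>spin_configs (box n). if (\<forall>x\<in>S. \<eta> x = \<xi> x) then ising_weight H (box n) \<eta> else 0)
     / (\<Sum>\<eta>\<in>spin_configs (box n). ising_weight H (box n) \<eta>)"

definition config_space :: "(int \<times> int \<Rightarrow> real) measure" where
  "config_space = PiM UNIV (\<lambda>_. borel)"

definition is_ising_measure :: "real \<Rightarrow> (int \<times> int \<Rightarrow> real) measure \<Rightarrow> bool" where
  "is_ising_measure H P \<longleftrightarrow>
     sets P = sets config_space \<and> prob_space P \<and>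
     (AE \<sigma> in P. \<forall>x. \<sigma> x \<in> {-1, 1}) \<and>
     (\<forall>S \<xi>. finite S \<longrightarrow> \<xi> \<in> S \<rightarrow> {-1, 1} \<longrightarrow>
        (\<lambda>n. fv_prob H n S \<xi>) \<longlonglongrightarrow> measure P {\<sigma> \<in> space P. \<forall>x\<in>S. \<sigma> x = \<xi> x})"

definition trunc2 :: "(int \<times> int \<Rightarrow> real) measure \<Rightarrow> int \<times> int \<Rightarrow> int \<times> int \<Rightarrow> real" where
  "trunc2 P i j = (\<integral>\<sigma>. \<sigma> i * \<sigma> j \<partial>P) - (\<integral>\<sigma>. \<sigma> i \<partial>P) * (\<integral>\<sigma>. \<sigma> j \<partial>P)"

definition lattice_point :: "real \<Rightarrow> int \<times> int \<Rightarrow> real \<times> real" where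
  "lattice_point a i = (a * of_int (fst i), a * of_int (snd i))"

definition lattice_field :: "real \<Rightarrow> (real \<times> real \<Rightarrow> real) \<Rightarrow> (int \<times> int \<Rightarrow> real) \<Rightarrow> real" where
  "lattice_field a f \<sigma> = a powr (15/8) *
     (\<Sum>i\<in>{i. f (lattice_point a i) \<noteq> 0}. \<sigma> i * f (lattice_point a i))"

coinductive smooth_fun :: "('a::real_normed_vector \<Rightarrow> real) \<Rightarrow> bool" where
  "(\<forall>x. f differentiable (at x)) \<Longrightarrow> (\<forall>v. smooth_fun (\<lambda>x. frechet_derivative f (at x) v))
    \<Longrightarrow> smooth_fun f"

definition test_fun :: "(real \<times> real \<Rightarrow> real) \<Rightarrow> bool" where
  "test_fun f \<longleftrightarrow> smooth_fun f \<and> compact (closure {x. f x \<noteq> 0})"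

end

(* The Ising weight is log-supermodular, so the infinite-volume measure is positively associated
   (Fortuin-Kasteleyn-Ginibre). For a 1-Lipschitz truncation T both sums of the field of |f| with
   plus or minus T of the field of f are increasing in the spins, so the covariance of the
   truncated lattice fields of f and g is at most a^(15/4) times the sum of |f||g| against the
   truncated two-point function. The lattice bound turns this into a Riemann sum of the asserted
   double integral. Truncated fields are bounded continuous functions of the fields, so the bound
   passes to the scaling limit without any uniform integrability; finally the truncation is removed
   by square integrability of the limit, which follows from the uniform variance bound. *)

theory Submission
  imports Defs
begin

subsection \<open>The four functions theorem and the FKG inequality\<close>

text \<open>Clamping is compatible with positive association because only increments are compared:
  for f of variable sign the field is not monotone, but raising spins changes its clamped value by
  at most the increase of the field of |f|. The exponents then match exactly: two factors a^(15/8)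
  and the a^(1/4) of the lattice bound give a^4, the volume of a product of two planar cells. Two
  points are delicate. The lattice bound is silent on the diagonal, where the truncated function is
  at most 1 = a^(1/4) a^(-1/4), and the limiting kernel is unbounded there; a single integrable
  majorant has to cover both effects. And bounded clamped variances alone do not bound second
  moments, since the clamped means might drift off; that a real random variable puts half of its
  mass on a bounded interval excludes this.\<close>

lemma four_functions_one_point:
  fixes a0 a1 b0 b1 c0 c1 d0 d1 :: real
  assumes nn: "a0 \<ge> 0" "a1 \<ge> 0" "b0 \<ge> 0" "b1 \<ge> 0" "c0 \<ge> 0" "c1 \<ge> 0" "d0 \<ge> 0" "d1 \<ge> 0"
    and "a0 * b0 \<le> c0 * d0" "a0 * b1 \<le> c1 * d0" "a1 * b0 \<le> c1 * d0" "a1 * b1 \<le> c1 * d1"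
  shows "(a0 + a1) * (b0 + b1) \<le> (c0 + c1) * (d0 + d1)"
proof -
  \<comment> \<open>Only the cross products resist termwise comparison: p and q are each at most M,
    but p + q must be bounded by M + N. The product of the two outer hypotheses gives pq \<le> MN,
    and expanding (M - p)(M - q) \<ge> 0 then gives M(p + q) \<le> M(M + N). If M = 0, then p = q =
    0.\<close>
  define p q M N where "p = a0 * b1" and "q = a1 * b0" and "M = c1 * d0" and "N = c0 * d1"
  have pq: "p \<ge> 0" "q \<ge> 0" "p \<le> M" "q \<le> M" "N \<ge> 0"
    using assms by (auto simp: p_def q_def M_def N_def)
  have "(a0 * b0) * (a1 * b1) \<le> (c0 * d0) * (c1 * d1)"
    using assms by (intro mult_mono[OF assms(9,12)]) auto
  then have "p * q \<le> M * N"
    by (simp add: p_def q_def M_def N_def mult_ac)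
  moreover have "0 \<le> (M - p) * (M - q)"
    using pq by auto
  ultimately have "M * (p + q) \<le> M * (M + N)"
    by (simp add: algebra_simps)
  then have "p + q \<le> M + N"
    using pq by (cases "M = 0") auto
  then show ?thesis
    using assms(9,12) by (simp add: p_def q_def M_def N_def algebra_simps)
qed

lemma sum_Pow_insert:
  assumes "finite S" "x \<notin> S"
  shows "(\<Sum>A\<in>Pow (insert x S). f A) = (\<Sum>A\<in>Pow S. f A + f (insert x A))"
proof -
  have "inj_on (insert x) (Pow S)"
    using assms(2) by (auto simp: inj_on_def)
  moreover have "Pow S \<inter> insert x ` Pow S = {}"
    using assms(2) by auto
  ultimately show ?thesis
    using assms(1) by (simp add: Pow_insert sum.union_disjoint sum.reindex sum.distrib)
qed

text \<open>This is the Ahlswede-Daykin theorem. Summing each function over the fibre consisting of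
  A and \<open>insert x A\<close> gives four functions on subsets of S which satisfy the same
  hypothesis by the one-point case; hence the induction keeps all four arbitrary.\<close>

theorem four_functions:
  fixes \<alpha> \<beta> \<gamma> \<delta> :: "'a set \<Rightarrow> real"
  assumes "finite S"
    and "\<And>A. A \<subseteq> S \<Longrightarrow> \<alpha> A \<ge> 0" "\<And>A. A \<subseteq> S \<Longrightarrow> \<beta> A \<ge> 0"
    and "\<And>A. A \<subseteq> S \<Longrightarrow> \<gamma> A \<ge> 0" "\<And>A. A \<subseteq> S \<Longrightarrow> \<delta> A \<ge> 0"
    and "\<And>A B. A \<subseteq> S \<Longrightarrow> B \<subseteq> S \<Longrightarrow> \<alpha> A * \<beta> B \<le> \<gamma> (A \<union> B) * \<delta> (A \<inter> B)"
  shows "(\<Sum>A\<in>Pow S. \<alpha> A) * (\<Sum>A\<in>Pow S. \<beta> A) \<le> (\<Sum>A\<in>Pow S. \<gamma> A) * (\<Sum>A\<in>Pow S. \<delta> A)"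
  using assms
proof (induction S arbitrary: \<alpha> \<beta> \<gamma> \<delta> rule: finite_induct)
  case empty
  then show ?case by auto
next
  case (insert x S)
  note nn = insert.prems(1-4) and le = insert.prems(5)
  let ?s = "\<lambda>f A. f A + f (insert x A) :: real"
  have "(\<Sum>A\<in>Pow S. ?s \<alpha> A) * (\<Sum>A\<in>Pow S. ?s \<beta> A) \<le> (\<Sum>A\<in>Pow S. ?s \<gamma> A) * (\<Sum>A\<in>Pow S. ?s \<delta> A)"
  proof (rule insert.IH)
    fix A B assume AB: "A \<subseteq> S" "B \<subseteq> S"
    then have "x \<notin> A" "x \<notin> B" using insert.hyps by auto
    then have eqs: "A \<union> insert x B = insert x (A \<union> B)" "insert x A \<union> B = insert x (A \<union> B)"
      "insert x A \<union> insert x B = insert x (A \<union> B)"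
      "A \<inter> insert x B = A \<inter> B" "insert x A \<inter> B = A \<inter> B" "insert x A \<inter> insert x B = insert x (A \<inter> B)"
      by auto
    have sub: "A \<subseteq> insert x S" "B \<subseteq> insert x S" "insert x A \<subseteq> insert x S" "insert x B \<subseteq> insert x S"
      "A \<union> B \<subseteq> insert x S" "A \<inter> B \<subseteq> insert x S" "insert x (A \<union> B) \<subseteq> insert x S"
      "insert x (A \<inter> B) \<subseteq> insert x S"
      using AB by auto
    show "?s \<alpha> A * ?s \<beta> B \<le> ?s \<gamma> (A \<union> B) * ?s \<delta> (A \<inter> B)"
      by (rule four_functions_one_point)
        (use sub nn le[of A B] le[of A "insert x B"] le[of "insert x A" B]
           le[of "insert x A" "insert x B"] in \<open>simp_all add: eqs\<close>)
  qed (auto intro!: add_nonneg_nonneg nn)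
  then show ?case
    unfolding sum_Pow_insert[OF insert.hyps] .
qed

text \<open>The four functions are \<mu>f, \<mu>g, \<mu>fg and \<mu>: at A \<union> B the two
  increasing factors are at least f A and g B. Nonnegativity is arranged by subtracting the values
  at the empty set, which changes both sides by the same amount, as covariances ignore
  constants.\<close>

corollary fkg_inequality:
  fixes \<mu> f g :: "'a set \<Rightarrow> real"
  assumes fin: "finite S"
    and nn: "\<And>A. A \<subseteq> S \<Longrightarrow> \<mu> A \<ge> 0"
    and sm: "\<And>A B. A \<subseteq> S \<Longrightarrow> B \<subseteq> S \<Longrightarrow> \<mu> A * \<mu> B \<le> \<mu> (A \<union> B) * \<mu> (A \<inter> B)"
    and f: "\<And>A B. A \<subseteq> B \<Longrightarrow> B \<subseteq> S \<Longrightarrow> f A \<le> f B"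
    and g: "\<And>A B. A \<subseteq> B \<Longrightarrow> B \<subseteq> S \<Longrightarrow> g A \<le> g B"
  shows "(\<Sum>A\<in>Pow S. \<mu> A * f A) * (\<Sum>A\<in>Pow S. \<mu> A * g A)
           \<le> (\<Sum>A\<in>Pow S. \<mu> A * (f A * g A)) * (\<Sum>A\<in>Pow S. \<mu> A)"
proof -
  define f' g' where "f' A = f A - f {}" and "g' A = g A - g {}" for A
  have f': "f' A \<ge> 0" if "A \<subseteq> S" for A using f[of "{}" A] that by (auto simp: f'_def)
  have g': "g' A \<ge> 0" if "A \<subseteq> S" for A using g[of "{}" A] that by (auto simp: g'_def)
  have "(\<Sum>A\<in>Pow S. \<mu> A * f' A) * (\<Sum>A\<in>Pow S. \<mu> A * g' A)
      \<le> (\<Sum>A\<in>Pow S. \<mu> A * (f' A * g' A)) * (\<Sum>A\<in>Pow S. \<mu> A)"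
  proof (rule four_functions[OF fin])
    fix A B assume AB: "A \<subseteq> S" "B \<subseteq> S"
    have "(\<mu> A * \<mu> B) * (f' A * g' B) \<le> (\<mu> (A \<union> B) * \<mu> (A \<inter> B)) * (f' (A \<union> B) * g' (A \<union> B))"
    proof (rule mult_mono[OF sm[OF AB] mult_mono])
      show "f' A \<le> f' (A \<union> B)" "g' B \<le> g' (A \<union> B)"
        using f[of A "A \<union> B"] g[of B "A \<union> B"] AB by (auto simp: f'_def g'_def)
      show "0 \<le> f' (A \<union> B)" "0 \<le> g' B" "0 \<le> f' A * g' B"
        using AB f' g' by auto
      show "0 \<le> \<mu> (A \<union> B) * \<mu> (A \<inter> B)"
        using AB by (intro mult_nonneg_nonneg nn) auto
    qed
    then show "\<mu> A * f' A * (\<mu> B * g' B) \<le> \<mu> (A \<union> B) * (f' (A \<union> B) * g' (A \<union> B)) * \<mu> (A \<inter> B)"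
      by (simp add: mult_ac)
  qed (use nn f' g' in auto)
  moreover have "(\<Sum>A\<in>Pow S. \<mu> A * f' A) = (\<Sum>A\<in>Pow S. \<mu> A * f A) - f {} * (\<Sum>A\<in>Pow S. \<mu> A)"
    "(\<Sum>A\<in>Pow S. \<mu> A * g' A) = (\<Sum>A\<in>Pow S. \<mu> A * g A) - g {} * (\<Sum>A\<in>Pow S. \<mu> A)"
    "(\<Sum>A\<in>Pow S. \<mu> A * (f' A * g' A)) = (\<Sum>A\<in>Pow S. \<mu> A * (f A * g A))
        - g {} * (\<Sum>A\<in>Pow S. \<mu> A * f A) - f {} * (\<Sum>A\<in>Pow S. \<mu> A * g A)
        + f {} * g {} * (\<Sum>A\<in>Pow S. \<mu> A)"
    unfolding f'_def g'_def sum_distrib_left sum_subtractf[symmetric] sum.distrib[symmetric]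
    by (intro sum.cong; simp add: algebra_simps)+
  ultimately show ?thesis
    by (simp add: algebra_simps)
qed

subsection \<open>Positive association of the Ising measure\<close>

text \<open>Configurations are encoded by their sets of plus sites, so that pointwise maximum and
  minimum become union and intersection. Every site outside the set is minus, so
  \<open>restrict\<close> is applied to obtain the extensional functions of
  \<open>spin_configs\<close>.\<close>

definition spin :: "(int \<times> int) set \<Rightarrow> int \<times> int \<Rightarrow> real" where
  "spin A x = (if x \<in> A then 1 else -1)"

lemma spin_mono: "A \<subseteq> B \<Longrightarrow> spin A x \<le> spin B x"
  by (auto simp: spin_def)

lemma beta_c_nonneg: "beta_c \<ge> 0"
  unfolding beta_c_def by simp

lemma finite_box [simp]: "finite (box n)"
  by (simp add: box_def)

lemma sum_spin_configs:
  "(\<Sum>\<eta>\<in>spin_configs \<Lambda>. F \<eta>) = (\<Sum>A\<in>Pow \<Lambda>. F (restrict (spin A) \<Lambda>))"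
proof -
  have inv: "restrict (spin {x\<in>\<Lambda>. \<eta> x = 1}) \<Lambda> = \<eta>" if "\<eta> \<in> spin_configs \<Lambda>" for \<eta>
  proof
    fix x
    show "restrict (spin {x\<in>\<Lambda>. \<eta> x = 1}) \<Lambda> x = \<eta> x"
      using that PiE_mem[of \<eta> \<Lambda> "\<lambda>_. {-1, 1}" x] PiE_arb[of \<eta> \<Lambda> "\<lambda>_. {-1, 1}" x]
      by (cases "x \<in> \<Lambda>") (auto simp: spin_configs_def spin_def)
  qed
  show ?thesis
  proof (rule sum.reindex_bij_witness)
    fix \<eta> assume "\<eta> \<in> spin_configs \<Lambda>"
    then show "restrict (spin {x\<in>\<Lambda>. \<eta> x = 1}) \<Lambda> = \<eta>"
      by (rule inv)
    then show "F (restrict (spin {x\<in>\<Lambda>. \<eta> x = 1}) \<Lambda>) = F \<eta>"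
      by simp
  qed (auto simp: spin_configs_def spin_def split: if_splits)
qed

lemma ising_weight_pos: "ising_weight H \<Lambda> \<eta> > 0"
  by (simp add: ising_weight_def)

text \<open>A product of two spins is supermodular in the plus set, bond by bond, and
  \<open>beta_c\<close> \<ge> 0 preserves the direction. The field term is modular, so it
  contributes an equality whatever the sign of H.\<close>

lemma ising_weight_supermodular:
  "ising_weight H \<Lambda> (restrict (spin A) \<Lambda>) * ising_weight H \<Lambda> (restrict (spin B) \<Lambda>)
     \<le> ising_weight H \<Lambda> (restrict (spin (A \<union> B)) \<Lambda>) * ising_weight H \<Lambda> (restrict (spin (A \<inter> B)) \<Lambda>)"
proof -
  define nb where "nb x = {(fst x + 1, snd x), (fst x, snd x + 1)} \<inter> \<Lambda>" for x :: "int \<times> int"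
  define J where "J A = (\<Sum>x\<in>\<Lambda>. \<Sum>y\<in>nb x. spin A x * spin A y)" for A
  define L where "L A = (\<Sum>x\<in>\<Lambda>. spin A x)" for A
  have w: "ising_weight H \<Lambda> (restrict (spin A) \<Lambda>) = exp (beta_c * J A + H * L A)" for A
    unfolding ising_weight_def J_def L_def nb_def
    by (intro arg_cong[where f = exp] arg_cong2[where f = "(+)"] arg_cong2[where f = "(*)"] sum.cong) auto
  have "J A + J B \<le> J (A \<union> B) + J (A \<inter> B)"
    unfolding J_def sum.distrib[symmetric] by (intro sum_mono) (auto simp: spin_def)
  then have "beta_c * (J A + J B) \<le> beta_c * (J (A \<union> B) + J (A \<inter> B))"
    by (intro mult_left_mono beta_c_nonneg)
  moreover have "L A + L B = L (A \<union> B) + L (A \<inter> B)"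
    unfolding L_def sum.distrib[symmetric] by (intro sum.cong) (auto simp: spin_def)
  then have "H * (L A + L B) = H * (L (A \<union> B) + L (A \<inter> B))" by simp
  ultimately show ?thesis
    unfolding w exp_add[symmetric] by (simp add: algebra_simps)
qed

text \<open>Averages over the marginal on S are pulled back to the whole box, where the weight is
  supermodular. Monotonicity survives, because A \<subseteq> B implies A \<inter> S \<subseteq> B
  \<inter> S.\<close>

lemma sum_fv_prob:
  assumes "finite S" "S \<subseteq> box n"
  shows "(\<Sum>B\<in>Pow S. f B * fv_prob H n S (spin B)) =
     (\<Sum>A\<in>Pow (box n). ising_weight H (box n) (restrict (spin A) (box n)) * f (A \<inter> S))
       / (\<Sum>A\<in>Pow (box n). ising_weight H (box n) (restrict (spin A) (box n)))"
proof -
  let ?w = "\<lambda>A. ising_weight H (box n) (restrict (spin A) (box n))"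
  have *: "(\<forall>x\<in>S. restrict (spin A) (box n) x = spin B x) \<longleftrightarrow> A \<inter> S = B" if "B \<subseteq> S" for A B
  proof -
    have "(\<forall>x\<in>S. restrict (spin A) (box n) x = spin B x) \<longleftrightarrow> (\<forall>x\<in>S. x \<in> A \<longleftrightarrow> x \<in> B)"
      using assms(2) by (intro ball_cong) (auto simp: spin_def)
    then show ?thesis using that by auto
  qed
  have "(\<Sum>B\<in>Pow S. f B * (\<Sum>A\<in>Pow (box n). if A \<inter> S = B then ?w A else 0))
      = (\<Sum>A\<in>Pow (box n). \<Sum>B\<in>Pow S. if A \<inter> S = B then ?w A * f B else 0)"
    unfolding sum_distrib_left by (subst sum.swap) (auto intro!: sum.cong)
  also have "\<dots> = (\<Sum>A\<in>Pow (box n). ?w A * f (A \<inter> S))"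
    using assms(1) by (intro sum.cong) (auto simp: sum.delta')
  finally show ?thesis
    unfolding fv_prob_def sum_spin_configs
    unfolding times_divide_eq_right sum_divide_distrib[symmetric]
    by (subst sum.cong[OF refl, where h = "\<lambda>B. f B * (\<Sum>A\<in>Pow (box n). if A \<inter> S = B then ?w A else 0)"])
      (simp_all only: * Pow_iff)
qed

lemma fv_prob_association:
  assumes "finite S" "S \<subseteq> box n"
    and f: "\<And>A B. A \<subseteq> B \<Longrightarrow> B \<subseteq> S \<Longrightarrow> f A \<le> f B"
    and g: "\<And>A B. A \<subseteq> B \<Longrightarrow> B \<subseteq> S \<Longrightarrow> g A \<le> g B"
  shows "(\<Sum>B\<in>Pow S. f B * fv_prob H n S (spin B)) * (\<Sum>B\<in>Pow S. g B * fv_prob H n S (spin B))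
    \<le> (\<Sum>B\<in>Pow S. (f B * g B) * fv_prob H n S (spin B))"
proof -
  let ?w = "\<lambda>A. ising_weight H (box n) (restrict (spin A) (box n))"
  have Z: "(\<Sum>A\<in>Pow (box n). ?w A) > 0"
    by (intro sum_pos ising_weight_pos) auto
  have "(\<Sum>A\<in>Pow (box n). ?w A * f (A \<inter> S)) * (\<Sum>A\<in>Pow (box n). ?w A * g (A \<inter> S))
     \<le> (\<Sum>A\<in>Pow (box n). ?w A * (f (A \<inter> S) * g (A \<inter> S))) * (\<Sum>A\<in>Pow (box n). ?w A)"
    by (intro fkg_inequality ising_weight_supermodular f g)
      (auto simp: less_imp_le[OF ising_weight_pos])
  then show ?thesis
    using Z unfolding sum_fv_prob[OF assms(1,2)] by (simp add: field_simps)
qed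

lemma finite_subset_box:
  assumes "finite S"
  shows "eventually (\<lambda>n. S \<subseteq> box n) sequentially"
proof -
  have "\<forall>x\<in>S. eventually (\<lambda>n. x \<in> box n) sequentially"
  proof
    fix x :: "int \<times> int"
    show "eventually (\<lambda>n. x \<in> box n) sequentially"
      unfolding eventually_sequentially
      by (intro exI[of _ "nat (\<bar>fst x\<bar> + \<bar>snd x\<bar>)"]) (cases x, auto simp: box_def)
  qed
  then show ?thesis
    using assms by (simp add: eventually_ball_finite_distrib subset_eq)
qed

section \<open>From finite boxes to the infinite-volume measure\<close>

locale ising =
  fixes H :: real and P :: "(int \<times> int \<Rightarrow> real) measure"
  assumes is_ising: "is_ising_measure H P"
begin

sublocale prob_space P
  using is_ising by (simp add: is_ising_measure_def)

lemma sets_P: "sets P = sets config_space"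
  and spins: "AE \<sigma> in P. \<forall>x. \<sigma> x \<in> {-1, 1}"
  and fv_limit: "finite S \<Longrightarrow> \<xi> \<in> S \<rightarrow> {-1, 1} \<Longrightarrow>
    (\<lambda>n. fv_prob H n S \<xi>) \<longlonglongrightarrow> prob {\<sigma> \<in> space P. \<forall>x\<in>S. \<sigma> x = \<xi> x}"
  using is_ising by (auto simp: is_ising_measure_def)

lemma space_P [simp]: "space P = UNIV"
  using sets_eq_imp_space_eq[OF sets_P] by (simp add: config_space_def space_PiM)

lemma spin_measurable [measurable]: "(\<lambda>\<sigma>. \<sigma> x) \<in> borel_measurable P"
  unfolding measurable_cong_sets[OF sets_P refl] config_space_def by simp

lemma cylinder_measurable [measurable]:
  "finite S \<Longrightarrow> {\<sigma>. \<forall>x\<in>S. \<sigma> x = \<xi> x} \<in> sets P"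
proof -
  assume "finite S"
  then have "{\<sigma> \<in> space P. \<forall>x\<in>S. \<sigma> x = \<xi> x} \<in> sets P" by measurable
  then show ?thesis by simp
qed

text \<open>Spins are almost surely 1 or -1, so a function of the sites in S agrees almost surely
  with a finite combination of cylinder indicators. Its expectation is thus expressed by the
  cylinder probabilities, the quantities that \<open>is_ising_measure\<close> gives as finite-volume
  limits.\<close>

lemma expectation_local:
  fixes F :: "(int \<times> int \<Rightarrow> real) \<Rightarrow> real"
  assumes S: "finite S" and m: "F \<in> borel_measurable P"
    and loc: "\<And>\<sigma> \<tau>. (\<And>x. x \<in> S \<Longrightarrow> \<sigma> x = \<tau> x) \<Longrightarrow> F \<sigma> = F \<tau>"
  shows "integrable P F"
    and "expectation F = (\<Sum>B\<in>Pow S. F (spin B) * prob {\<sigma>. \<forall>x\<in>S. \<sigma> x = spin B x})"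
proof -
  define G where "G \<sigma> = (\<Sum>B\<in>Pow S. F (spin B) * indicator {\<sigma>. \<forall>x\<in>S. \<sigma> x = spin B x} \<sigma>)" for \<sigma>
  have int: "integrable P G"
    unfolding G_def using S
    by (intro Bochner_Integration.integrable_sum integrable_mult_right integrable_real_indicator)
      (auto simp: less_top[symmetric])
  have AE: "AE \<sigma> in P. F \<sigma> = G \<sigma>"
    using spins
  proof eventually_elim
    case (elim \<sigma>)
    \<comment> \<open>Among the subsets of S, only the plus set of \<sigma> gives a cylinder
      containing \<sigma>, so a single summand survives.\<close>
    define B0 where "B0 = {x\<in>S. \<sigma> x = 1}"
    have "(\<forall>x\<in>S. \<sigma> x = spin B x) \<longleftrightarrow> B = B0" if "B \<subseteq> S" for B
      using that elim by (auto simp: spin_def B0_def split: if_splits)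
    then have "G \<sigma> = (\<Sum>B\<in>Pow S. if B = B0 then F (spin B) else 0)"
      unfolding G_def by (intro sum.cong) auto
    also have "\<dots> = F (spin B0)"
      using S by (simp add: sum.delta B0_def)
    also have "\<dots> = F \<sigma>"
    proof (intro loc)
      fix x assume "x \<in> S"
      moreover have "\<sigma> x = -1 \<or> \<sigma> x = 1" using elim by blast
      ultimately show "spin B0 x = \<sigma> x" by (auto simp: spin_def B0_def)
    qed
    finally show ?case by simp
  qed
  have mG: "G \<in> borel_measurable P" using int by auto
  show "integrable P F"
    using integrable_cong_AE[OF m mG AE] int by blast
  have "expectation F = expectation G"
    by (rule integral_cong_AE[OF m mG AE])
  also have "\<dots> = (\<Sum>B\<in>Pow S. F (spin B) * prob {\<sigma>. \<forall>x\<in>S. \<sigma> x = spin B x})"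
    unfolding G_def using S
    by (subst Bochner_Integration.integral_sum) (auto simp: less_top[symmetric])
  finally show "expectation F = \<dots>" .
qed

lemma expectation_local_limit:
  fixes F :: "(int \<times> int \<Rightarrow> real) \<Rightarrow> real"
  assumes S: "finite S" and m: "F \<in> borel_measurable P"
    and loc: "\<And>\<sigma> \<tau>. (\<And>x. x \<in> S \<Longrightarrow> \<sigma> x = \<tau> x) \<Longrightarrow> F \<sigma> = F \<tau>"
  shows "(\<lambda>n. \<Sum>B\<in>Pow S. F (spin B) * fv_prob H n S (spin B)) \<longlonglongrightarrow> expectation F"
proof -
  have "(\<lambda>n. fv_prob H n S (spin B)) \<longlonglongrightarrow> prob {\<sigma>. \<forall>x\<in>S. \<sigma> x = spin B x}" for B
    using fv_limit[OF S, of "spin B"] by (simp add: spin_def)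
  then show ?thesis
    by (subst expectation_local(2)[OF assms]) (auto intro!: tendsto_sum tendsto_mult)
qed

theorem association:
  fixes F G :: "(int \<times> int \<Rightarrow> real) \<Rightarrow> real"
  assumes S: "finite S" and m [measurable]: "F \<in> borel_measurable P" "G \<in> borel_measurable P"
    and F: "\<And>\<sigma> \<tau>. (\<And>x. x \<in> S \<Longrightarrow> \<sigma> x \<le> \<tau> x) \<Longrightarrow> F \<sigma> \<le> F \<tau>"
    and G: "\<And>\<sigma> \<tau>. (\<And>x. x \<in> S \<Longrightarrow> \<sigma> x \<le> \<tau> x) \<Longrightarrow> G \<sigma> \<le> G \<tau>"
  shows "expectation F * expectation G \<le> expectation (\<lambda>\<sigma>. F \<sigma> * G \<sigma>)"
proof (rule tendsto_le[OF sequentially_bot])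
  \<comment> \<open>The monotonicity hypotheses compare only sites in S; used in both directions
    they force F and G to depend on those sites alone.\<close>
  have locF: "F \<sigma> = F \<tau>" if "\<And>x. x \<in> S \<Longrightarrow> \<sigma> x = \<tau> x" for \<sigma> \<tau>
    using F[of \<sigma> \<tau>] F[of \<tau> \<sigma>] that by auto
  have locG: "G \<sigma> = G \<tau>" if "\<And>x. x \<in> S \<Longrightarrow> \<sigma> x = \<tau> x" for \<sigma> \<tau>
    using G[of \<sigma> \<tau>] G[of \<tau> \<sigma>] that by auto
  show "(\<lambda>n. (\<Sum>B\<in>Pow S. F (spin B) * fv_prob H n S (spin B)) * (\<Sum>B\<in>Pow S. G (spin B) * fv_prob H n S (spin B)))
      \<longlonglongrightarrow> expectation F * expectation G"
    by (intro tendsto_mult expectation_local_limit S m locF locG) simp_all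
  show "(\<lambda>n. \<Sum>B\<in>Pow S. (F (spin B) * G (spin B)) * fv_prob H n S (spin B)) \<longlonglongrightarrow> expectation (\<lambda>\<sigma>. F \<sigma> * G \<sigma>)"
    by (intro expectation_local_limit[OF S] borel_measurable_times m arg_cong2[where f = "(*)"] locF locG)
      simp_all
  show "\<forall>\<^sub>F n in sequentially. (\<Sum>B\<in>Pow S. F (spin B) * fv_prob H n S (spin B)) * (\<Sum>B\<in>Pow S. G (spin B) * fv_prob H n S (spin B))
     \<le> (\<Sum>B\<in>Pow S. (F (spin B) * G (spin B)) * fv_prob H n S (spin B))"
    using finite_subset_box[OF S]
  proof eventually_elim
    case (elim n)
    show ?case
      by (rule fv_prob_association[OF S elim, where f = "\<lambda>B. F (spin B)" and g = "\<lambda>B. G (spin B)"])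
        (rule F G, rule spin_mono, assumption)+
  qed
qed

text \<open>Covers the pairs i = j, which the lattice bound leaves out: the squared spin is 1 almost
  surely, and a square is subtracted from it.\<close>

lemma trunc2_diag_le: "trunc2 P i i \<le> 1"
proof -
  have "AE \<sigma> in P. \<sigma> i * \<sigma> i = 1"
    using spins by eventually_elim (metis insert_iff empty_iff mult_1 square_eq_1_iff)
  then have "expectation (\<lambda>\<sigma>. \<sigma> i * \<sigma> i) = expectation (\<lambda>_. 1)"
    by (intro integral_cong_AE) auto
  then show ?thesis
    using prob_space by (simp add: trunc2_def)
qed

text \<open>Newman's comparison: polarising positive association of the increasing pairs
  \<open>F' + F\<close>, \<open>G' + G\<close> and \<open>F' - F\<close>, \<open>G' - G\<close>.\<close>

theorem covariance_comparison:
  fixes F G F' G' :: "(int \<times> int \<Rightarrow> real) \<Rightarrow> real"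
  assumes S: "finite S"
    and m [measurable]: "F \<in> borel_measurable P" "G \<in> borel_measurable P"
      "F' \<in> borel_measurable P" "G' \<in> borel_measurable P"
    and F: "\<And>\<sigma> \<tau>. (\<And>x. x \<in> S \<Longrightarrow> \<sigma> x \<le> \<tau> x) \<Longrightarrow> \<bar>F \<tau> - F \<sigma>\<bar> \<le> F' \<tau> - F' \<sigma>"
    and G: "\<And>\<sigma> \<tau>. (\<And>x. x \<in> S \<Longrightarrow> \<sigma> x \<le> \<tau> x) \<Longrightarrow> \<bar>G \<tau> - G \<sigma>\<bar> \<le> G' \<tau> - G' \<sigma>"
  shows "\<bar>expectation (\<lambda>\<sigma>. F \<sigma> * G \<sigma>) - expectation F * expectation G\<bar>
           \<le> expectation (\<lambda>\<sigma>. F' \<sigma> * G' \<sigma>) - expectation F' * expectation G'"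
proof -
  have loc: "F \<sigma> = F \<tau>" "F' \<sigma> = F' \<tau>" "G \<sigma> = G \<tau>" "G' \<sigma> = G' \<tau>"
    if "\<And>x. x \<in> S \<Longrightarrow> \<sigma> x = \<tau> x" for \<sigma> \<tau>
    using F[of \<sigma> \<tau>] F[of \<tau> \<sigma>] G[of \<sigma> \<tau>] G[of \<tau> \<sigma>] that by auto
  have int: "integrable P F" "integrable P F'" "integrable P G" "integrable P G'"
    by (intro expectation_local(1)[OF S] m loc; simp)+
  have int2: "integrable P (\<lambda>\<sigma>. F \<sigma> * G \<sigma>)" "integrable P (\<lambda>\<sigma>. F' \<sigma> * G' \<sigma>)"
    "integrable P (\<lambda>\<sigma>. F \<sigma> * G' \<sigma>)" "integrable P (\<lambda>\<sigma>. F' \<sigma> * G \<sigma>)"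
    by (intro expectation_local(1)[OF S] borel_measurable_times m arg_cong2[where f = "(*)"] loc; simp)+
  have pos: "expectation (\<lambda>\<sigma>. F' \<sigma> + s * F \<sigma>) * expectation (\<lambda>\<sigma>. G' \<sigma> + t * G \<sigma>)
      \<le> expectation (\<lambda>\<sigma>. (F' \<sigma> + s * F \<sigma>) * (G' \<sigma> + t * G \<sigma>))"
    if st: "s = 1 \<or> s = -1" "t = 1 \<or> t = -1" for s t
  proof (rule association[OF S])
    fix \<sigma> \<tau> :: "int \<times> int \<Rightarrow> real" assume le: "\<And>x. x \<in> S \<Longrightarrow> \<sigma> x \<le> \<tau> x"
    from st F[of \<sigma> \<tau>] le show "F' \<sigma> + s * F \<sigma> \<le> F' \<tau> + s * F \<tau>" by auto
    from st G[of \<sigma> \<tau>] le show "G' \<sigma> + t * G \<sigma> \<le> G' \<tau> + t * G \<tau>" by auto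
  qed measurable
  \<comment> \<open>The covariance of F' + sF and G' + tG expands into four covariances. Adding the
    cases (1, 1) and (-1, -1) cancels the mixed ones and bounds -Cov(F, G) by Cov(F', G'); adding
    (1, -1) and (-1, 1) bounds Cov(F, G).\<close>
  show ?thesis
    using pos[of 1 1] pos[of "-1" "-1"] pos[of 1 "-1"] pos[of "-1" 1]
    by (simp add: algebra_simps int int2)
qed

text \<open>Raising spins moves \<open>T (X u)\<close> by no more than the increase of the sum with
  weights |u|. The comparison therefore applies with these unclamped linear sums as dominating
  functions, and the resulting bound does not depend on T.\<close>

lemma covariance_Lipschitz_le:
  fixes u v :: "int \<times> int \<Rightarrow> real" and T :: "real \<Rightarrow> real"
  assumes I: "finite I" and T: "\<And>x y. \<bar>T x - T y\<bar> \<le> \<bar>x - y\<bar>"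
    and [measurable]: "T \<in> borel_measurable borel"
  defines "X \<equiv> \<lambda>u \<sigma>. \<Sum>i\<in>I. \<sigma> i * u i"
  shows "\<bar>expectation (\<lambda>\<sigma>. T (X u \<sigma>) * T (X v \<sigma>)) - expectation (\<lambda>\<sigma>. T (X u \<sigma>)) * expectation (\<lambda>\<sigma>. T (X v \<sigma>))\<bar>
           \<le> (\<Sum>i\<in>I. \<Sum>j\<in>I. \<bar>u i\<bar> * \<bar>v j\<bar> * trunc2 P i j)"
proof -
  have [measurable]: "X u \<in> borel_measurable P" for u
    unfolding X_def by measurable
  have comparison: "\<bar>T (X u \<tau>) - T (X u \<sigma>)\<bar> \<le> X (\<lambda>i. \<bar>u i\<bar>) \<tau> - X (\<lambda>i. \<bar>u i\<bar>) \<sigma>"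
    if "\<And>i. i \<in> I \<Longrightarrow> \<sigma> i \<le> \<tau> i" for u \<sigma> \<tau>
  proof -
    have "\<bar>T (X u \<tau>) - T (X u \<sigma>)\<bar> \<le> \<bar>X u \<tau> - X u \<sigma>\<bar>" by (rule T)
    also have "\<dots> = \<bar>\<Sum>i\<in>I. (\<tau> i - \<sigma> i) * u i\<bar>"
      by (simp add: X_def sum_subtractf algebra_simps)
    also have "\<dots> \<le> (\<Sum>i\<in>I. \<bar>(\<tau> i - \<sigma> i) * u i\<bar>)"
      by (rule sum_abs)
    also have "\<dots> = (\<Sum>i\<in>I. (\<tau> i - \<sigma> i) * \<bar>u i\<bar>)"
      using that by (intro sum.cong) (auto simp: abs_mult)
    finally show ?thesis by (simp add: X_def sum_subtractf algebra_simps)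
  qed
  have spin_int: "integrable P (\<lambda>\<sigma>. \<sigma> i)" for i
    by (rule expectation_local(1)[of "{i}"]) auto
  have spin2_int: "integrable P (\<lambda>\<sigma>. \<sigma> i * \<sigma> j)" for i j
    by (rule expectation_local(1)[of "{i, j}"]) auto
  let ?X = "X (\<lambda>i. \<bar>u i\<bar>)" and ?Y = "X (\<lambda>i. \<bar>v i\<bar>)"
  have XY: "?X \<sigma> * ?Y \<sigma> = (\<Sum>i\<in>I. \<Sum>j\<in>I. \<bar>u i\<bar> * \<bar>v j\<bar> * (\<sigma> i * \<sigma> j))" for \<sigma>
    by (simp add: X_def sum_product mult_ac)
  have EX: "expectation (X w) = (\<Sum>i\<in>I. w i * expectation (\<lambda>\<sigma>. \<sigma> i))" for w
    unfolding X_def by (simp add: spin_int mult.commute)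
  have "expectation (\<lambda>\<sigma>. ?X \<sigma> * ?Y \<sigma>) - expectation ?X * expectation ?Y
      = (\<Sum>i\<in>I. \<Sum>j\<in>I. \<bar>u i\<bar> * \<bar>v j\<bar> * expectation (\<lambda>\<sigma>. \<sigma> i * \<sigma> j))
        - (\<Sum>i\<in>I. \<Sum>j\<in>I. (\<bar>u i\<bar> * expectation (\<lambda>\<sigma>. \<sigma> i)) * (\<bar>v j\<bar> * expectation (\<lambda>\<sigma>. \<sigma> j)))"
    unfolding XY EX sum_product by (simp add: spin2_int)
  also have "\<dots> = (\<Sum>i\<in>I. \<Sum>j\<in>I. \<bar>u i\<bar> * \<bar>v j\<bar> * trunc2 P i j)"
    by (simp add: trunc2_def sum_subtractf[symmetric] algebra_simps)
  finally have *: "expectation (\<lambda>\<sigma>. ?X \<sigma> * ?Y \<sigma>) - expectation ?X * expectation ?Y = \<dots>" .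
  show ?thesis
    unfolding *[symmetric] by (rule covariance_comparison[OF I _ _ _ _ comparison comparison]) auto
qed

end

subsection \<open>Riemann sums with a singular kernel\<close>

lemma borel_measurable_fst_real [measurable (raw)]:
  fixes f :: "'a \<Rightarrow> real \<times> real"
  shows "f \<in> M \<rightarrow>\<^sub>M borel \<Longrightarrow> (\<lambda>x. fst (f x)) \<in> borel_measurable M"
  by (erule measurable_compose) (intro borel_measurable_continuous_onI continuous_intros)

lemma borel_measurable_snd_real [measurable (raw)]:
  fixes f :: "'a \<Rightarrow> real \<times> real"
  shows "f \<in> M \<rightarrow>\<^sub>M borel \<Longrightarrow> (\<lambda>x. snd (f x)) \<in> borel_measurable M"
  by (erule measurable_compose) (intro borel_measurable_continuous_onI continuous_intros)

text \<open>The exponent -1/4 lies above -1, so the singularity is integrable already on the line.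
  The negative half is the reflection of the positive one.\<close>

lemma nn_integral_singular_power_finite:
  fixes L :: real
  assumes "L \<ge> 0"
  shows "(\<integral>\<^sup>+t. ennreal (indicator {-L..L} t * (\<bar>t\<bar> / 2) powr (-1/4)) \<partial>lborel) < \<infinity>"
proof -
  define w where "w t = indicator {0..L} t * t powr (-1/4)" for t :: real
  have [measurable]: "w \<in> borel_measurable borel" unfolding w_def by measurable
  have "((\<lambda>t. t powr (-1/4)) has_integral (L powr (-1/4 + 1) / (-1/4 + 1))) {0..L}"
    by (rule has_integral_powr_from_0) (use assms in auto)
  then have "((\<lambda>t. if t \<in> {0..L} then t powr (-1/4) else 0) has_integral (L powr (-1/4 + 1) / (-1/4 + 1))) UNIV"
    unfolding has_integral_restrict_UNIV .
  moreover have "(\<lambda>t. if t \<in> {0..L} then t powr (-1/4) else 0) = w"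
    by (auto simp: w_def fun_eq_iff)
  ultimately have "(w has_integral (L powr (-1/4 + 1) / (-1/4 + 1))) UNIV"
    by simp
  from nn_integral_has_integral_lborel[OF _ _ this]
  have w: "(\<integral>\<^sup>+t. ennreal (w t) \<partial>lborel) < \<infinity>"
    by (auto simp: w_def)
  have w': "(\<integral>\<^sup>+t. ennreal (w (-t)) \<partial>lborel) < \<infinity>"
    using w nn_integral_real_affine[of "\<lambda>t. ennreal (w t)" "-1" 0] by simp
  have "(\<integral>\<^sup>+t. ennreal (indicator {-L..L} t * (\<bar>t\<bar> / 2) powr (-1/4)) \<partial>lborel)
      \<le> (\<integral>\<^sup>+t. ennreal (2 powr (1/4)) * (ennreal (w t) + ennreal (w (-t))) \<partial>lborel)"
  proof (intro nn_integral_mono)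
    fix t :: real
    have "indicator {-L..L} t * (\<bar>t\<bar> / 2) powr (-1/4) \<le> 2 powr (1/4) * (w t + w (-t))"
      by (auto simp: w_def indicator_def powr_divide powr_minus_divide abs_if)
    moreover have "w t \<ge> 0" "w (-t) \<ge> 0" by (auto simp: w_def)
    ultimately show "ennreal (indicator {-L..L} t * (\<bar>t\<bar> / 2) powr (-1/4))
        \<le> ennreal (2 powr (1/4)) * (ennreal (w t) + ennreal (w (-t)))"
      by (simp add: ennreal_mult[symmetric] ennreal_plus[symmetric] del: ennreal_plus)
  qed
  also have "\<dots> < \<infinity>"
    using w w' by (simp add: nn_integral_cmult nn_integral_add ennreal_mult_less_top)
  finally show ?thesis .
qed

definition square :: "real \<Rightarrow> (real \<times> real) set" where
  "square R = {-R..R} \<times> {-R..R}"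

lemma square_borel [measurable]: "square R \<in> sets borel"
  unfolding square_def by (intro borel_closed closed_Times) auto

text \<open>Bounding the planar distance below by the difference of first coordinates leaves a
  singularity that is still integrable, so a one-dimensional integral suffices. The division by 2
  pays for moving both points to the corners of their cells.\<close>

definition dominator :: "real \<Rightarrow> (real \<times> real) \<times> (real \<times> real) \<Rightarrow> real" where
  "dominator R p = indicator (square R) (fst p) * indicator (square R) (snd p)
     * (\<bar>fst (fst p) - fst (snd p)\<bar> / 2) powr (-1/4)"

lemma dominator_integrable:
  assumes R: "R \<ge> 0"
  shows "integrable (lborel \<Otimes>\<^sub>M lborel) (dominator R)"
proof (rule integrableI_nonneg)
  show m [measurable]: "dominator R \<in> borel_measurable (lborel \<Otimes>\<^sub>M lborel)"
    unfolding dominator_def by measurable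
  show "AE p in lborel \<Otimes>\<^sub>M lborel. 0 \<le> dominator R p"
    by (simp add: dominator_def)
  \<comment> \<open>First coordinates in the interval from -R to R differ by at most 2R. Translation
    and reflection invariance then give the same bound W for every x.\<close>
  define w where "w t = indicator {-(2*R)..2*R} t * (\<bar>t\<bar> / 2) powr (-1/4)" for t :: real
  have [measurable]: "w \<in> borel_measurable borel" unfolding w_def by measurable
  define W where "W = (\<integral>\<^sup>+t. ennreal (w t) \<partial>lborel)"
  have W: "W < \<infinity>"
    unfolding W_def w_def by (rule nn_integral_singular_power_finite) (use R in auto)
  have sq: "emeasure lborel (square R) < \<infinity>"
    unfolding square_def lborel_prod[symmetric]
    using R by (subst lborel.emeasure_pair_measure_Times) (auto simp: ennreal_mult_less_top)
  have prod_meas: "(\<lambda>y. ennreal (w (z - fst y)) * indicator {-R..R} (snd y)) \<in> borel_measurable borel" for z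
    by measurable
  have inner: "(\<integral>\<^sup>+y. ennreal (dominator R (x, y)) \<partial>lborel) \<le> indicator (square R) x * (W * ennreal (2*R))" for x
  proof -
    have "(\<integral>\<^sup>+y. ennreal (dominator R (x, y)) \<partial>lborel)
        \<le> (\<integral>\<^sup>+y. indicator (square R) x * (ennreal (w (fst x - fst y)) * indicator {-R..R} (snd y)) \<partial>lborel)"
      by (intro nn_integral_mono)
        (auto simp: dominator_def w_def square_def indicator_def)
    also have "\<dots> = indicator (square R) x * (\<integral>\<^sup>+y. ennreal (w (fst x - fst y)) * indicator {-R..R} (snd y) \<partial>lborel)"
      by (rule nn_integral_cmult) simp
    also have "(\<integral>\<^sup>+y. ennreal (w (fst x - fst y)) * indicator {-R..R} (snd y) \<partial>lborel)
        = (\<integral>\<^sup>+y1. \<integral>\<^sup>+y2. ennreal (w (fst x - y1)) * indicator {-R..R} y2 \<partial>lborel \<partial>lborel)"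
      by (subst lborel_prod[symmetric], subst lborel.nn_integral_fst[symmetric]) (simp_all add: lborel_prod prod_meas)
    also have "\<dots> = (\<integral>\<^sup>+y1. ennreal (w (fst x - y1)) * ennreal (2*R) \<partial>lborel)"
      using R by (subst nn_integral_cmult) (auto simp: emeasure_lborel_Icc_eq)
    also have "\<dots> = (\<integral>\<^sup>+y1. ennreal (w (fst x - y1)) \<partial>lborel) * ennreal (2*R)"
      by (rule nn_integral_multc) simp
    also have "(\<integral>\<^sup>+y1. ennreal (w (fst x - y1)) \<partial>lborel) = W"
      unfolding W_def using nn_integral_real_affine[of "\<lambda>t. ennreal (w t)" "-1" "fst x"] by simp
    finally show ?thesis .
  qed
  have "(\<integral>\<^sup>+p. ennreal (dominator R p) \<partial>(lborel \<Otimes>\<^sub>M lborel))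
      = (\<integral>\<^sup>+x. \<integral>\<^sup>+y. ennreal (dominator R (x, y)) \<partial>lborel \<partial>lborel)"
    by (rule lborel.nn_integral_fst[symmetric]) simp
  also have "\<dots> \<le> (\<integral>\<^sup>+x. indicator (square R) x * (W * ennreal (2*R)) \<partial>lborel)"
    by (intro nn_integral_mono inner)
  also have "\<dots> = emeasure lborel (square R) * (W * ennreal (2*R))"
    by (subst nn_integral_multc) auto
  also have "\<dots> < \<infinity>"
    using W sq by (simp add: ennreal_mult_less_top)
  finally show "(\<integral>\<^sup>+p. ennreal (dominator R p) \<partial>(lborel \<Otimes>\<^sub>M lborel)) < \<infinity>" .
qed

text \<open>Where the first coordinates agree the majorant vanishes, because
  \<open>0 powr (-1/4)\<close> is 0, so domination may fail there. Distinct first coordinates also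
  separate the cells in the pointwise limit.\<close>

lemma AE_fst_neq:
  "AE p in lborel \<Otimes>\<^sub>M lborel. fst (fst p :: real \<times> real) \<noteq> fst (snd p :: real \<times> real)"
proof (rule lborel_pair.AE_pair_measure)
  show "{p \<in> space (lborel \<Otimes>\<^sub>M lborel). fst (fst p :: real \<times> real) \<noteq> fst (snd p :: real \<times> real)} \<in> sets (lborel \<Otimes>\<^sub>M lborel)"
    using measurable_fst[of "lborel :: (real \<times> real) measure" "lborel :: (real \<times> real) measure"]
      measurable_snd[of "lborel :: (real \<times> real) measure" "lborel :: (real \<times> real) measure"]
    by (intro borel_measurable_neq borel_measurable_fst_real) simp_all
  have "(1, 0) \<in> (Basis :: (real \<times> real) set)"
    by (simp add: Basis_prod_def)
  from AE_lborel_inner_neq[OF this]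
  have "AE y in lborel. fst (y :: real \<times> real) \<noteq> c" for c
    by (simp add: inner_prod_def)
  then show "AE x in lborel. AE y in lborel. fst (fst (x, y) :: real \<times> real) \<noteq> fst (snd (x, y :: real \<times> real))"
    by (simp add: eq_commute)
qed

section \<open>Lattice cells and step functions\<close>

definition cell_index :: "real \<Rightarrow> real \<times> real \<Rightarrow> int \<times> int" where
  "cell_index a x = (\<lfloor>fst x / a\<rfloor>, \<lfloor>snd x / a\<rfloor>)"

text \<open>Half-open cells tile the plane for a > 0, so each point lies in exactly one of them; the
  lattice point is the lower left corner.\<close>

definition cell :: "real \<Rightarrow> int \<times> int \<Rightarrow> (real \<times> real) set" where
  "cell a i = {a * fst i ..< a * (fst i + 1)} \<times> {a * snd i ..< a * (snd i + 1)}"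

lemma mem_cell_iff: "a > 0 \<Longrightarrow> x \<in> cell a i \<longleftrightarrow> cell_index a x = i"
  by (cases i, cases x) (auto simp: cell_def cell_index_def floor_eq_iff field_simps)

lemma cell_borel [measurable]: "cell a i \<in> sets borel"
  unfolding cell_def borel_prod[symmetric] by simp

lemma emeasure_cell: "a > 0 \<Longrightarrow> emeasure lborel (cell a i) = ennreal (a\<^sup>2)"
  unfolding cell_def lborel_prod[symmetric]
  by (subst lborel.emeasure_pair_measure_Times)
    (auto simp: algebra_simps power2_eq_square ennreal_mult)

lemma lattice_point_cell_index:
  assumes "a > 0"
  shows "\<bar>fst x - fst (lattice_point a (cell_index a x))\<bar> \<le> a"
    and "\<bar>snd x - snd (lattice_point a (cell_index a x))\<bar> \<le> a"
    and "fst (lattice_point a (cell_index a x)) \<le> fst x"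
    and "fst x < fst (lattice_point a (cell_index a x)) + a"
proof -
  have *: "a * \<lfloor>t / a\<rfloor> \<le> t \<and> t < a * \<lfloor>t / a\<rfloor> + a" for t
  proof -
    have "a * \<lfloor>t / a\<rfloor> \<le> a * (t / a)" "a * (t / a) < a * (\<lfloor>t / a\<rfloor> + 1)"
      using assms floor_correct[of "t / a"]
      by (intro mult_left_mono mult_strict_left_mono; simp)+
    then show ?thesis using assms by (simp add: algebra_simps)
  qed
  show "\<bar>fst x - fst (lattice_point a (cell_index a x))\<bar> \<le> a"
    "\<bar>snd x - snd (lattice_point a (cell_index a x))\<bar> \<le> a"
    "fst (lattice_point a (cell_index a x)) \<le> fst x"
    "fst x < fst (lattice_point a (cell_index a x)) + a"
    using *[of "fst x"] *[of "snd x"] by (auto simp: lattice_point_def cell_index_def)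
qed

lemma dist_lattice_point_ge:
  assumes "a > 0" "i \<noteq> j"
  shows "a \<le> dist (lattice_point a i) (lattice_point a j)"
proof -
  have *: "a \<le> \<bar>a * of_int k - a * of_int l\<bar>" if "k \<noteq> l" for k l :: int
  proof -
    have "1 \<le> \<bar>k - l\<bar>" using that by auto
    then have "1 \<le> \<bar>real_of_int k - real_of_int l\<bar>" by linarith
    then have "a * 1 \<le> a * \<bar>real_of_int k - real_of_int l\<bar>"
      using assms(1) by (intro mult_left_mono) auto
    also have "\<dots> = \<bar>a * of_int k - a * of_int l\<bar>"
      using assms(1) by (simp add: abs_mult flip: right_diff_distrib)
    finally show ?thesis by simp
  qed
  consider "fst i \<noteq> fst j" | "snd i \<noteq> snd j" using assms(2) by (auto simp: prod_eq_iff)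
  then show ?thesis
  proof cases
    case 1
    from *[OF this] dist_fst_le[of "lattice_point a i" "lattice_point a j"] show ?thesis
      by (simp add: lattice_point_def dist_real_def)
  next
    case 2
    from *[OF this] dist_snd_le[of "lattice_point a i" "lattice_point a j"] show ?thesis
      by (simp add: lattice_point_def dist_real_def)
  qed
qed

definition decay_kernel :: "real \<Rightarrow> real \<times> real \<Rightarrow> real \<times> real \<Rightarrow> real" where
  "decay_kernel m x y = dist x y powr (-1/4) * exp (- m * dist x y)"

text \<open>The lattice kernel is set to \<open>a powr (-1/4)\<close> on the diagonal: this accounts for
  \<open>trunc2 P i i \<le> 1 = a powr (1/4) * a powr (-1/4)\<close>, and it is still below the
  singular function dominating the off-diagonal part.\<close>

definition lattice_kernel :: "real \<Rightarrow> real \<Rightarrow> real \<Rightarrow> int \<times> int \<Rightarrow> int \<times> int \<Rightarrow> real" where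
  "lattice_kernel c m a i j =
     (if i = j then a powr (-1/4) else c * decay_kernel m (lattice_point a i) (lattice_point a j))"

text \<open>Both points move towards the lower left by less than a, so the difference of first
  coordinates exceeds the distance of the corners by at most a. In a common cell it is at most a,
  which accounts for the 1 in 1 + c. Distinct corners are at least a apart, so it is at most twice
  their distance, which accounts for the c.\<close>

lemma lattice_kernel_bounds:
  assumes a: "0 < a" and "c > 0" "m > 0" and neq: "fst x \<noteq> fst y"
  shows "0 \<le> lattice_kernel c m a (cell_index a x) (cell_index a y)"
    and "lattice_kernel c m a (cell_index a x) (cell_index a y) \<le> (1 + c) * (\<bar>fst x - fst y\<bar> / 2) powr (-1/4)"
proof -
  let ?x = "lattice_point a (cell_index a x)" and ?y = "lattice_point a (cell_index a y)"
  show "0 \<le> lattice_kernel c m a (cell_index a x) (cell_index a y)"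
    using assms by (simp add: lattice_kernel_def decay_kernel_def)
  have d: "\<bar>fst x - fst y\<bar> \<le> dist ?x ?y + a"
    using lattice_point_cell_index[OF a, of x] lattice_point_cell_index[OF a, of y]
      dist_fst_le[of ?x ?y] unfolding dist_real_def by linarith
  have pos: "\<bar>fst x - fst y\<bar> / 2 > 0" using neq by auto
  have c1: "z \<le> (1 + c) * z" if "z \<ge> 0" for z using that assms(2) by (simp add: algebra_simps)
  show "lattice_kernel c m a (cell_index a x) (cell_index a y) \<le> (1 + c) * (\<bar>fst x - fst y\<bar> / 2) powr (-1/4)"
  proof (cases "cell_index a x = cell_index a y")
    case True
    then have "\<bar>fst x - fst y\<bar> / 2 \<le> a" using d a by simp
    then have "a powr (-1/4) \<le> (\<bar>fst x - fst y\<bar> / 2) powr (-1/4)"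
      using pos by (intro powr_mono2') auto
    also have "\<dots> \<le> (1 + c) * (\<bar>fst x - fst y\<bar> / 2) powr (-1/4)" by (intro c1) auto
    finally show ?thesis using True by (simp add: lattice_kernel_def)
  next
    case False
    from dist_lattice_point_ge[OF a this] d have "\<bar>fst x - fst y\<bar> / 2 \<le> dist ?x ?y" by simp
    then have "dist ?x ?y powr (-1/4) \<le> (\<bar>fst x - fst y\<bar> / 2) powr (-1/4)"
      using pos by (intro powr_mono2') auto
    moreover have "exp (- m * dist ?x ?y) \<le> 1" using assms by simp
    ultimately have "decay_kernel m ?x ?y \<le> (\<bar>fst x - fst y\<bar> / 2) powr (-1/4) * 1"
      unfolding decay_kernel_def by (intro mult_mono) auto
    then have "c * decay_kernel m ?x ?y \<le> (1 + c) * (\<bar>fst x - fst y\<bar> / 2) powr (-1/4)"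
      using assms(2) by (intro mult_mono) (auto simp: decay_kernel_def)
    then show ?thesis using False by (simp add: lattice_kernel_def)
  qed
qed

definition step_fun :: "real \<Rightarrow> real \<Rightarrow> (real \<times> real \<Rightarrow> real) \<Rightarrow> (real \<times> real \<Rightarrow> real) \<Rightarrow> real
    \<Rightarrow> (real \<times> real) \<times> (real \<times> real) \<Rightarrow> real" where
  "step_fun c m f g a p =
     \<bar>f (lattice_point a (cell_index a (fst p)))\<bar> * \<bar>g (lattice_point a (cell_index a (snd p)))\<bar>
       * lattice_kernel c m a (cell_index a (fst p)) (cell_index a (snd p))"

lemma step_fun_eq_sum:
  assumes "a > 0" "finite I"
    and "{i. f (lattice_point a i) \<noteq> 0} \<subseteq> I" "{i. g (lattice_point a i) \<noteq> 0} \<subseteq> I"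
  shows "step_fun c m f g a = (\<lambda>p. \<Sum>i\<in>I. \<Sum>j\<in>I. \<bar>f (lattice_point a i)\<bar> * \<bar>g (lattice_point a j)\<bar>
      * lattice_kernel c m a i j * indicator (cell a i \<times> cell a j) p)"
proof
  fix p :: "(real \<times> real) \<times> (real \<times> real)"
  let ?t = "\<lambda>i j. \<bar>f (lattice_point a i)\<bar> * \<bar>g (lattice_point a j)\<bar> * lattice_kernel c m a i j"
  have "(\<Sum>i\<in>I. \<Sum>j\<in>I. ?t i j * indicator (cell a i \<times> cell a j) p)
      = (\<Sum>i\<in>I. if i = cell_index a (fst p)
            then (\<Sum>j\<in>I. if j = cell_index a (snd p) then ?t i j else 0) else 0)"
    using assms(1) by (intro sum.cong refl) (auto simp: indicator_def mem_Times_iff mem_cell_iff intro!: sum.cong sum.neutral)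
  also have "\<dots> = step_fun c m f g a p"
    using assms by (auto simp: sum.delta step_fun_def)
  finally show "step_fun c m f g a p = (\<Sum>i\<in>I. \<Sum>j\<in>I. ?t i j * indicator (cell a i \<times> cell a j) p)" ..
qed

text \<open>Each product of two planar cells has volume a^4, so the lattice sum is an integral
  without error term. The set I may be any finite set containing both supports, so that f and g can
  share it.\<close>

lemma integral_step_fun:
  assumes "a > 0" "finite I"
    and "{i. f (lattice_point a i) \<noteq> 0} \<subseteq> I" "{i. g (lattice_point a i) \<noteq> 0} \<subseteq> I"
  shows "step_fun c m f g a \<in> borel_measurable (lborel \<Otimes>\<^sub>M lborel)"
    and "integral\<^sup>L (lborel \<Otimes>\<^sub>M lborel) (step_fun c m f g a)
      = a ^ 4 * (\<Sum>i\<in>I. \<Sum>j\<in>I. \<bar>f (lattice_point a i)\<bar> * \<bar>g (lattice_point a j)\<bar> * lattice_kernel c m a i j)"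
proof -
  have em: "emeasure (lborel \<Otimes>\<^sub>M lborel) (cell a i \<times> cell a j) = ennreal (a ^ 4)" for i j
    using assms(1) by (subst lborel.emeasure_pair_measure_Times)
      (auto simp: emeasure_cell ennreal_mult[symmetric] power2_eq_square power4_eq_xxxx mult_ac)
  have me: "measure (lborel \<Otimes>\<^sub>M lborel) (cell a i \<times> cell a j) = a ^ 4" for i j
    using assms(1) by (simp add: measure_def em)
  have s: "cell a i \<times> cell a j \<in> sets (lborel \<Otimes>\<^sub>M lborel)" for i j by auto
  have int: "integrable (lborel \<Otimes>\<^sub>M lborel) (\<lambda>p. z * indicator (cell a i \<times> cell a j) p)" for i j and z :: real
    by (intro integrable_mult_right integrable_real_indicator s) (simp add: em)
  show "step_fun c m f g a \<in> borel_measurable (lborel \<Otimes>\<^sub>M lborel)"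
    unfolding step_fun_eq_sum[OF assms] using int by (intro borel_measurable_sum) auto
  show "integral\<^sup>L (lborel \<Otimes>\<^sub>M lborel) (step_fun c m f g a)
      = a ^ 4 * (\<Sum>i\<in>I. \<Sum>j\<in>I. \<bar>f (lattice_point a i)\<bar> * \<bar>g (lattice_point a j)\<bar> * lattice_kernel c m a i j)"
    unfolding step_fun_eq_sum[OF assms] sum_distrib_left
    by (subst Bochner_Integration.integral_sum, intro Bochner_Integration.integrable_sum int,
        intro sum.cong refl, subst Bochner_Integration.integral_sum, rule int)
      (simp add: me space_pair_measure mult.commute)
qed

lemma finite_lattice_support:
  assumes a: "a > 0" and R: "{x. f x \<noteq> 0} \<subseteq> square R"
  shows "finite {i. f (lattice_point a i) \<noteq> 0}"
proof (rule finite_subset)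
  show "{i. f (lattice_point a i) \<noteq> 0} \<subseteq> {- \<lceil>R / a\<rceil>..\<lceil>R / a\<rceil>} \<times> {- \<lceil>R / a\<rceil>..\<lceil>R / a\<rceil>}"
  proof
    have *: "- \<lceil>R / a\<rceil> \<le> k \<and> k \<le> \<lceil>R / a\<rceil>" if "- R \<le> a * of_int k" "a * of_int k \<le> R" for k
    proof -
      have "of_int k \<le> R / a" "of_int (- k) \<le> R / a" using a that by (auto simp: field_simps)
      then show ?thesis by linarith
    qed
    fix i assume "i \<in> {i. f (lattice_point a i) \<noteq> 0}"
    then have "lattice_point a i \<in> square R" using R by auto
    then show "i \<in> {- \<lceil>R / a\<rceil>..\<lceil>R / a\<rceil>} \<times> {- \<lceil>R / a\<rceil>..\<lceil>R / a\<rceil>}"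
      using *[of "fst i"] *[of "snd i"] by (auto simp: lattice_point_def square_def mem_Times_iff)
  qed
qed auto

text \<open>Dominated convergence of step functions is used because the kernel is unbounded near the
  diagonal. It also yields integrability of the limit, so Fubini turns the integral over pairs into
  the iterated one.\<close>

lemma riemann_sum_limit:
  fixes f g :: "real \<times> real \<Rightarrow> real" and a :: "nat \<Rightarrow> real"
  assumes c: "c > 0" and m: "m > 0" and R: "R \<ge> 0"
    and f: "continuous_on UNIV f" "{x. f x \<noteq> 0} \<subseteq> square R" "\<And>x. \<bar>f x\<bar> \<le> C"
    and g: "continuous_on UNIV g" "{x. g x \<noteq> 0} \<subseteq> square R" "\<And>x. \<bar>g x\<bar> \<le> C"
    and a: "\<And>n. 0 < a n" "\<And>n. a n \<le> 1" "a \<longlonglongrightarrow> 0"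
    and I: "\<And>n. finite (I n)" "\<And>n. {i. f (lattice_point (a n) i) \<noteq> 0} \<subseteq> I n"
      "\<And>n. {i. g (lattice_point (a n) i) \<noteq> 0} \<subseteq> I n"
  shows "(\<lambda>n. a n ^ 4 * (\<Sum>i\<in>I n. \<Sum>j\<in>I n. \<bar>f (lattice_point (a n) i)\<bar> * \<bar>g (lattice_point (a n) j)\<bar>
            * lattice_kernel c m (a n) i j))
         \<longlonglongrightarrow> c * (\<integral>x. (\<integral>y. \<bar>f x\<bar> * \<bar>g y\<bar> * dist x y powr (-1/4) * exp (- m * dist x y) \<partial>lborel) \<partial>lborel)"
proof -
  let ?M = "lborel \<Otimes>\<^sub>M lborel :: ((real \<times> real) \<times> (real \<times> real)) measure"
  define F where "F p = \<bar>f (fst p)\<bar> * \<bar>g (snd p)\<bar> * (c * decay_kernel m (fst p) (snd p))" for p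
  have [measurable]: "f \<in> borel_measurable borel" "g \<in> borel_measurable borel"
    using f(1) g(1) by (auto intro: borel_measurable_continuous_onI)
  have mF: "F \<in> borel_measurable ?M"
    unfolding F_def decay_kernel_def by measurable
  have C: "C \<ge> 0" using f(3)[of undefined] by linarith
  \<comment> \<open>As a n \<le> 1, every cell whose corner lies in \<open>square R\<close> is
    contained in \<open>square (R + 1)\<close>.\<close>
  have int_dom: "integrable ?M (\<lambda>p. C * C * (1 + c) * dominator (R + 1) p)"
    by (intro integrable_mult_right dominator_integrable) (use R in auto)
  have lim: "AE p in ?M. (\<lambda>n. step_fun c m f g (a n) p) \<longlonglongrightarrow> F p"
    using AE_fst_neq
  proof eventually_elim
    case (elim p)
    obtain x y where p: "p = (x, y)" by (cases p)
    have pt: "(\<lambda>n. lattice_point (a n) (cell_index (a n) z)) \<longlonglongrightarrow> z" for z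
    proof -
      have "(\<lambda>n. fst z - fst (lattice_point (a n) (cell_index (a n) z))) \<longlonglongrightarrow> 0"
        using lattice_point_cell_index(1)[OF a(1)]
        by (intro Lim_null_comparison[OF _ a(3)] always_eventually) (simp only: real_norm_def simp_thms)
      moreover have "(\<lambda>n. snd z - snd (lattice_point (a n) (cell_index (a n) z))) \<longlonglongrightarrow> 0"
        using lattice_point_cell_index(2)[OF a(1)]
        by (intro Lim_null_comparison[OF _ a(3)] always_eventually) (simp only: real_norm_def simp_thms)
      ultimately have "(\<lambda>n. (fst z - (fst z - fst (lattice_point (a n) (cell_index (a n) z))),
          snd z - (snd z - snd (lattice_point (a n) (cell_index (a n) z))))) \<longlonglongrightarrow> (fst z - 0, snd z - 0)"
        by (intro tendsto_intros)
      then show ?thesis by simp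
    qed
    have neq: "x \<noteq> y" using elim p by auto
    have cf: "(\<lambda>n. f (lattice_point (a n) (cell_index (a n) x))) \<longlonglongrightarrow> f x"
      by (rule continuous_on_tendsto_compose[OF f(1) pt]) auto
    have cg: "(\<lambda>n. g (lattice_point (a n) (cell_index (a n) y))) \<longlonglongrightarrow> g y"
      by (rule continuous_on_tendsto_compose[OF g(1) pt]) auto
    have "(\<lambda>n. c * decay_kernel m (lattice_point (a n) (cell_index (a n) x)) (lattice_point (a n) (cell_index (a n) y)))
        \<longlonglongrightarrow> c * decay_kernel m x y"
      unfolding decay_kernel_def using neq by (intro tendsto_intros pt) auto
    \<comment> \<open>Cells have width a n, so points whose first coordinates differ by more lie in
      different cells, and the diagonal value drops out of the pointwise limit.\<close>
    moreover have "\<forall>\<^sub>F n in sequentially. a n < \<bar>fst x - fst y\<bar>"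
      using elim p by (intro order_tendstoD(2)[OF a(3)]) auto
    then have "\<forall>\<^sub>F n in sequentially. lattice_kernel c m (a n) (cell_index (a n) x) (cell_index (a n) y)
        = c * decay_kernel m (lattice_point (a n) (cell_index (a n) x)) (lattice_point (a n) (cell_index (a n) y))"
    proof eventually_elim
      case (elim n)
      have "cell_index (a n) x \<noteq> cell_index (a n) y"
      proof
        assume "cell_index (a n) x = cell_index (a n) y"
        then show False
          using elim lattice_point_cell_index(3,4)[OF a(1)[of n], of x]
            lattice_point_cell_index(3,4)[OF a(1)[of n], of y] by auto
      qed
      then show ?case by (simp add: lattice_kernel_def)
    qed
    ultimately have "(\<lambda>n. lattice_kernel c m (a n) (cell_index (a n) x) (cell_index (a n) y)) \<longlonglongrightarrow> c * decay_kernel m x y"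
      by (simp add: tendsto_cong)
    then show ?case
      unfolding p step_fun_def F_def fst_conv snd_conv by (intro tendsto_mult tendsto_rabs cf cg)
  qed
  have bound: "AE p in ?M. norm (step_fun c m f g (a n) p) \<le> C * C * (1 + c) * dominator (R + 1) p" for n
    using AE_fst_neq
  proof eventually_elim
    case (elim p)
    obtain x y where p: "p = (x, y)" by (cases p)
    let ?x = "lattice_point (a n) (cell_index (a n) x)" and ?y = "lattice_point (a n) (cell_index (a n) y)"
    let ?k = "lattice_kernel c m (a n) (cell_index (a n) x) (cell_index (a n) y)"
    have k: "0 \<le> ?k" "?k \<le> (1 + c) * (\<bar>fst x - fst y\<bar> / 2) powr (-1/4)"
      using lattice_kernel_bounds[OF a(1) c m] elim p by auto
    have near: "z \<in> square (R + 1)" if "lattice_point (a n) (cell_index (a n) z) \<in> square R" for z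
      using that lattice_point_cell_index(1,2)[OF a(1)[of n], of z] a(2)[of n]
      by (auto simp: square_def mem_Times_iff)
    have dom: "0 \<le> dominator (R + 1) p" by (simp add: dominator_def)
    show ?case
    proof (cases "f ?x = 0 \<or> g ?y = 0")
      case True
      then have "step_fun c m f g (a n) p = 0" by (auto simp: step_fun_def p)
      then show ?thesis using dom C c by simp
    next
      case False
      then have "x \<in> square (R + 1)" "y \<in> square (R + 1)" using f(2) g(2) near[of x] near[of y] by auto
      then have "dominator (R + 1) p = (\<bar>fst x - fst y\<bar> / 2) powr (-1/4)"
        by (simp add: dominator_def p)
      moreover have "\<bar>f ?x\<bar> * \<bar>g ?y\<bar> * ?k \<le> (C * C) * ((1 + c) * (\<bar>fst x - fst y\<bar> / 2) powr (-1/4))"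
        using k C by (intro mult_mono f(3) g(3)) auto
      ultimately show ?thesis
        using k by (simp add: step_fun_def p abs_mult mult_ac)
    qed
  qed
  note dct = mF integral_step_fun(1)[OF a(1) I] int_dom lim bound
  have intF: "integrable ?M F"
    by (rule integrable_dominated_convergence[OF dct])
  have "(\<lambda>n. integral\<^sup>L ?M (step_fun c m f g (a n))) \<longlonglongrightarrow> integral\<^sup>L ?M F"
    by (rule integral_dominated_convergence[OF dct])
  moreover have "integral\<^sup>L ?M F = (\<integral>x. (\<integral>y. F (x, y) \<partial>lborel) \<partial>lborel)"
    by (rule lborel_pair.integral_fst'[OF intF, symmetric])
  moreover have "\<dots> = (\<integral>x. c * (\<integral>y. \<bar>f x\<bar> * \<bar>g y\<bar> * dist x y powr (-1/4) * exp (- m * dist x y) \<partial>lborel) \<partial>lborel)"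
    by (subst integral_mult_right_zero[symmetric]) (simp add: F_def decay_kernel_def mult_ac)
  ultimately show ?thesis
    unfolding integral_step_fun(2)[OF a(1) I] by simp
qed

subsection \<open>Truncation and passage to the scaling limit\<close>

lemma test_fun_continuous: "test_fun f \<Longrightarrow> continuous_on UNIV f"
proof -
  assume "test_fun f"
  then have "smooth_fun f" by (simp add: test_fun_def)
  then have "\<forall>x. f differentiable (at x)" by cases
  then show ?thesis
    by (auto intro!: continuous_at_imp_continuous_on differentiable_imp_continuous_within)
qed

lemma test_fun_support:
  assumes "test_fun f"
  obtains R where "R \<ge> 0" "{x. f x \<noteq> 0} \<subseteq> square R"
proof -
  have "bounded (closure {x. f x \<noteq> 0})"
    using assms by (simp add: test_fun_def compact_imp_bounded)
  then have "bounded {x. f x \<noteq> 0}"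
    by (rule bounded_subset) (rule closure_subset)
  then obtain R where R: "R > 0" "\<And>x. f x \<noteq> 0 \<Longrightarrow> norm x \<le> R"
    by (auto simp: bounded_pos)
  have "x \<in> square R" if "f x \<noteq> 0" for x
    using R(2)[OF that] norm_fst_le[of "fst x" "snd x"] norm_snd_le[of "snd x" "fst x"]
    by (auto simp: square_def mem_Times_iff)
  then show ?thesis
    using R(1) by (intro that[of R]) auto
qed

lemma test_fun_bounded:
  assumes "test_fun f"
  obtains C where "\<And>x. \<bar>f x\<bar> \<le> C"
proof -
  let ?K = "closure {x. f x \<noteq> 0}"
  have "compact (f ` ?K)"
    using assms test_fun_continuous[OF assms]
    by (intro compact_continuous_image) (auto simp: test_fun_def intro: continuous_on_subset)
  then obtain C where C: "\<And>y. y \<in> f ` ?K \<Longrightarrow> \<bar>y\<bar> \<le> C" "C > 0"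
    using compact_imp_bounded by (force simp: bounded_pos)
  have "\<bar>f x\<bar> \<le> C" for x
    using C closure_subset[of "{x. f x \<noteq> 0}"] by (cases "f x = 0") auto
  then show ?thesis by (rule that)
qed

text \<open>Continuity and boundedness make convergence in law applicable; the Lipschitz constant 1
  makes the covariance comparison applicable.\<close>

definition clamp_at :: "nat \<Rightarrow> real \<Rightarrow> real" where
  "clamp_at N x = max (- real N) (min (real N) x)"

lemma clamp_at_Lipschitz: "\<bar>clamp_at N x - clamp_at N y\<bar> \<le> \<bar>x - y\<bar>"
  by (auto simp: clamp_at_def)

lemma abs_clamp_at_le: "\<bar>clamp_at N x\<bar> \<le> \<bar>x\<bar>" "\<bar>clamp_at N x\<bar> \<le> real N"
  by (auto simp: clamp_at_def)

lemma clamp_at_eq: "\<bar>x\<bar> \<le> real N \<Longrightarrow> clamp_at N x = x"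
  by (auto simp: clamp_at_def)

lemma clamp_at_continuous [continuous_intros]:
  "continuous_on S f \<Longrightarrow> continuous_on S (\<lambda>x. clamp_at N (f x))"
  unfolding clamp_at_def by (intro continuous_intros)

lemma clamp_at_measurable [measurable]: "clamp_at N \<in> borel_measurable borel"
  unfolding clamp_at_def by measurable

lemma clamp_at_tendsto: "(\<lambda>N. clamp_at N x) \<longlonglongrightarrow> x"
proof -
  obtain N0 where "\<bar>x\<bar> \<le> real N0" using real_arch_simple by blast
  then have "\<forall>\<^sub>F N in sequentially. clamp_at N x = x"
    unfolding eventually_sequentially by (intro exI[of _ N0]) (auto intro!: clamp_at_eq)
  then show ?thesis by (rule tendsto_eventually)
qed

section \<open>Square integrability and removal of the truncation\<close>

context prob_space
begin

text \<open>Supplies an interval that does not depend on the truncation level; the 1/2 is the origin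
  of the 2 in \<open>sqrt (2 * B)\<close> below.\<close>

lemma eventually_half_mass:
  assumes [measurable]: "X \<in> borel_measurable M"
  shows "\<exists>K::nat. prob {\<omega> \<in> space M. \<bar>X \<omega>\<bar> \<le> real K} > 1/2"
proof -
  have "(\<lambda>K::nat. prob {\<omega> \<in> space M. \<bar>X \<omega>\<bar> \<le> real K}) \<longlonglongrightarrow> prob (\<Union>K::nat. {\<omega> \<in> space M. \<bar>X \<omega>\<bar> \<le> real K})"
    by (rule finite_Lim_measure_incseq) (auto simp: incseq_def)
  moreover have "(\<Union>K::nat. {\<omega> \<in> space M. \<bar>X \<omega>\<bar> \<le> real K}) = space M"
    using real_arch_simple by auto
  ultimately have "(\<lambda>K::nat. prob {\<omega> \<in> space M. \<bar>X \<omega>\<bar> \<le> real K}) \<longlonglongrightarrow> 1"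
    by (simp add: prob_space)
  from order_tendstoD(1)[OF this, of "1/2"] show ?thesis
    by (auto simp: eventually_sequentially)
qed

text \<open>Half of the mass of \<open>X\<close> lies in a fixed interval \<open>{-K..K}\<close>, on which all truncations
  agree; a bound on the variances therefore forces the truncated means to stay bounded.\<close>

lemma square_integrable_if_clamp_variance_le:
  fixes X :: "'a \<Rightarrow> real"
  assumes m [measurable]: "X \<in> borel_measurable M"
    and B: "\<And>N. expectation (\<lambda>\<omega>. (clamp_at N (X \<omega>))\<^sup>2) - (expectation (\<lambda>\<omega>. clamp_at N (X \<omega>)))\<^sup>2 \<le> B"
  shows "integrable M (\<lambda>\<omega>. (X \<omega>)\<^sup>2)"
proof -
  obtain K :: nat where K: "prob {\<omega> \<in> space M. \<bar>X \<omega>\<bar> \<le> real K} > 1/2"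
    using eventually_half_mass[OF m] by auto
  let ?A = "{\<omega> \<in> space M. \<bar>X \<omega>\<bar> \<le> real K}"
  define \<mu> where "\<mu> N = expectation (\<lambda>\<omega>. clamp_at N (X \<omega>))" for N
  have int: "integrable M (\<lambda>\<omega>. clamp_at N (X \<omega>))" "integrable M (\<lambda>\<omega>. (clamp_at N (X \<omega>))\<^sup>2)" for N
  proof -
    show "integrable M (\<lambda>\<omega>. clamp_at N (X \<omega>))"
      by (rule integrable_const_bound[where B = "real N"]) (auto intro: abs_clamp_at_le)
    have "\<bar>clamp_at N x\<bar>\<^sup>2 \<le> (real N)\<^sup>2" for x
      by (intro power_mono abs_clamp_at_le) auto
    then show "integrable M (\<lambda>\<omega>. (clamp_at N (X \<omega>))\<^sup>2)"
      by (intro integrable_const_bound[where B = "(real N)\<^sup>2"]) auto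
  qed
  have B0: "0 \<le> B"
    using B[of 0] by (simp add: clamp_at_def)
  \<comment> \<open>Put s = \<open>sqrt (2 * B)\<close>, so that s^2 / 2 = B. A mean farther than K
    + s from 0 would be more than s away from all values between -K and K, and half of the mass
    would already contribute more than B to the variance.\<close>
  have mean: "\<bar>\<mu> N\<bar> \<le> real K + sqrt (2 * B)" if N: "N \<ge> K" for N
  proof (rule ccontr)
    assume "\<not> ?thesis"
    then have big: "\<bar>\<mu> N\<bar> - real K > sqrt (2 * B)" by simp
    then have pos: "\<bar>\<mu> N\<bar> - real K > 0"
      using B0 real_sqrt_ge_zero[of "2 * B"] by linarith
    have "(\<bar>\<mu> N\<bar> - real K)\<^sup>2 * prob ?A = expectation (\<lambda>\<omega>. (\<bar>\<mu> N\<bar> - real K)\<^sup>2 * indicator ?A \<omega>)"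
      by simp
    also have "\<dots> \<le> expectation (\<lambda>\<omega>. (clamp_at N (X \<omega>) - \<mu> N)\<^sup>2)"
    proof (rule integral_mono)
      show "integrable M (\<lambda>\<omega>. (clamp_at N (X \<omega>) - \<mu> N)\<^sup>2)"
        by (simp add: power2_diff int)
      show "(\<bar>\<mu> N\<bar> - real K)\<^sup>2 * indicator ?A \<omega> \<le> (clamp_at N (X \<omega>) - \<mu> N)\<^sup>2" for \<omega>
      proof (cases "\<omega> \<in> ?A")
        case True
        then have "clamp_at N (X \<omega>) = X \<omega>" using N by (intro clamp_at_eq) auto
        then have "\<bar>\<mu> N\<bar> - real K \<le> \<bar>clamp_at N (X \<omega>) - \<mu> N\<bar>" using True by auto
        with pos have "(\<bar>\<mu> N\<bar> - real K)\<^sup>2 \<le> \<bar>clamp_at N (X \<omega>) - \<mu> N\<bar>\<^sup>2"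
          by (intro power_mono) auto
        with True show ?thesis by simp
      qed auto
    qed (auto intro!: integrable_real_indicator simp: less_top[symmetric])
    also have "\<dots> = expectation (\<lambda>\<omega>. (clamp_at N (X \<omega>))\<^sup>2) - (\<mu> N)\<^sup>2"
      by (simp add: power2_diff int \<mu>_def[symmetric] prob_space) (simp add: power2_eq_square)
    also have "\<dots> \<le> B" unfolding \<mu>_def by (rule B)
    finally have "(\<bar>\<mu> N\<bar> - real K)\<^sup>2 * prob ?A \<le> B" .
    moreover have "(sqrt (2 * B))\<^sup>2 < (\<bar>\<mu> N\<bar> - real K)\<^sup>2"
      using big B0 by (intro power_strict_mono) auto
    then have "2 * B < (\<bar>\<mu> N\<bar> - real K)\<^sup>2" using B0 by simp
    moreover have "(\<bar>\<mu> N\<bar> - real K)\<^sup>2 * (1/2) \<le> (\<bar>\<mu> N\<bar> - real K)\<^sup>2 * prob ?A"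
      using K by (intro mult_left_mono) auto
    ultimately show False by simp
  qed
  define C where "C = B + (real K + sqrt (2 * B))\<^sup>2"
  have second: "expectation (\<lambda>\<omega>. (clamp_at N (X \<omega>))\<^sup>2) \<le> C" if "N \<ge> K" for N
    using B[of N] power_mono[OF mean[OF that], of 2] by (simp add: C_def \<mu>_def)
  \<comment> \<open>Fatou's lemma; the lower limit only sees levels N \<ge> K, where the second
    moment is bounded by the variance bound plus the squared bound on the mean.\<close>
  have "(\<integral>\<^sup>+\<omega>. ennreal ((X \<omega>)\<^sup>2) \<partial>M) = (\<integral>\<^sup>+\<omega>. liminf (\<lambda>N. ennreal ((clamp_at N (X \<omega>))\<^sup>2)) \<partial>M)"
    by (intro nn_integral_cong lim_imp_Liminf[symmetric] tendsto_ennrealI tendsto_power clamp_at_tendsto) simp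
  also have "\<dots> \<le> liminf (\<lambda>N. \<integral>\<^sup>+\<omega>. ennreal ((clamp_at N (X \<omega>))\<^sup>2) \<partial>M)"
    by (rule nn_integral_liminf) measurable
  also have "\<dots> = liminf (\<lambda>N. ennreal (expectation (\<lambda>\<omega>. (clamp_at N (X \<omega>))\<^sup>2)))"
    by (simp add: nn_integral_eq_integral int)
  also have "\<dots> \<le> liminf (\<lambda>N::nat. ennreal C)"
    by (rule Liminf_mono) (auto simp: eventually_sequentially intro!: exI[of _ K] ennreal_leI second)
  also have "\<dots> < \<infinity>" by (simp add: Liminf_const)
  finally show ?thesis
    by (intro integrableI_nonneg) auto
qed

text \<open>Square integrability supplies the majorants: the sum of the two squares for the product,
  and |X| and |Y| for the means, which are integrable because the total mass is finite.\<close>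

lemma covariance_clamp_limit:
  fixes X Y :: "'a \<Rightarrow> real"
  assumes [measurable]: "X \<in> borel_measurable M" "Y \<in> borel_measurable M"
    and X: "integrable M (\<lambda>\<omega>. (X \<omega>)\<^sup>2)" and Y: "integrable M (\<lambda>\<omega>. (Y \<omega>)\<^sup>2)"
  shows "(\<lambda>N. expectation (\<lambda>\<omega>. clamp_at N (X \<omega>) * clamp_at N (Y \<omega>))
            - expectation (\<lambda>\<omega>. clamp_at N (X \<omega>)) * expectation (\<lambda>\<omega>. clamp_at N (Y \<omega>)))
    \<longlonglongrightarrow> expectation (\<lambda>\<omega>. X \<omega> * Y \<omega>) - expectation X * expectation Y"
proof -
  have intXY: "integrable M X" "integrable M Y"
    by (rule square_integrable_imp_integrable; fact)+
  have "(\<lambda>N. expectation (\<lambda>\<omega>. clamp_at N (X \<omega>) * clamp_at N (Y \<omega>))) \<longlonglongrightarrow> expectation (\<lambda>\<omega>. X \<omega> * Y \<omega>)"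
  proof (rule integral_dominated_convergence[where w = "\<lambda>\<omega>. (X \<omega>)\<^sup>2 + (Y \<omega>)\<^sup>2"])
    show "AE \<omega> in M. norm (clamp_at N (X \<omega>) * clamp_at N (Y \<omega>)) \<le> (X \<omega>)\<^sup>2 + (Y \<omega>)\<^sup>2" for N
    proof (intro AE_I2)
      fix \<omega>
      have "norm (clamp_at N (X \<omega>) * clamp_at N (Y \<omega>)) \<le> \<bar>X \<omega>\<bar> * \<bar>Y \<omega>\<bar>"
        unfolding real_norm_def abs_mult by (intro mult_mono abs_clamp_at_le) auto
      moreover have "2 * (\<bar>X \<omega>\<bar> * \<bar>Y \<omega>\<bar>) \<le> (X \<omega>)\<^sup>2 + (Y \<omega>)\<^sup>2"
        using sum_squares_bound[of "\<bar>X \<omega>\<bar>" "\<bar>Y \<omega>\<bar>"] by simp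
      moreover have "0 \<le> \<bar>X \<omega>\<bar> * \<bar>Y \<omega>\<bar>" by simp
      ultimately show "norm (clamp_at N (X \<omega>) * clamp_at N (Y \<omega>)) \<le> (X \<omega>)\<^sup>2 + (Y \<omega>)\<^sup>2"
        by linarith
    qed
  qed (use X Y in \<open>auto intro!: tendsto_mult clamp_at_tendsto\<close>)
  moreover have "(\<lambda>N. expectation (\<lambda>\<omega>. clamp_at N (Z \<omega>))) \<longlonglongrightarrow> expectation Z"
    if "integrable M Z" for Z :: "'a \<Rightarrow> real"
    using that by (intro integral_dominated_convergence[where w = "\<lambda>\<omega>. \<bar>Z \<omega>\<bar>"])
      (auto intro!: clamp_at_tendsto abs_clamp_at_le)
  ultimately show ?thesis
    using intXY by (intro tendsto_diff tendsto_mult)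
qed

end

text \<open>A Bochner integral of a non-integrable function is 0 by default; square integrability in
  the conclusion makes the left side a genuine covariance. Convergence in law is stated for pairs of
  fields because a covariance involves their joint law.\<close>

theorem theorem2:
  fixes h c m :: real
    and P :: "real \<Rightarrow> (int \<times> int \<Rightarrow> real) measure"
    and M :: "'w measure"
    and \<Phi> :: "(real \<times> real \<Rightarrow> real) \<Rightarrow> 'w \<Rightarrow> real"
  assumes h_pos: "h > 0"
    and ising: "\<forall>a>0. is_ising_measure (a powr (15/8) * h) (P a)"
    and M_prob: "prob_space M"
    and Phi_rv: "\<forall>f. test_fun f \<longrightarrow> \<Phi> f \<in> borel_measurable M"
    and conv_law: "\<forall>f g F. test_fun f \<longrightarrow> test_fun g \<longrightarrow>
          continuous_on UNIV (F :: real \<times> real \<Rightarrow> real) \<longrightarrow> bounded (range F) \<longrightarrow>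
          ((\<lambda>a. \<integral>\<sigma>. F (lattice_field a f \<sigma>, lattice_field a g \<sigma>) \<partial>(P a))
             \<longlongrightarrow> (\<integral>\<omega>. F (\<Phi> f \<omega>, \<Phi> g \<omega>) \<partial>M)) (at_right 0)"
    and c_pos: "c > 0" and m_pos: "m > 0"
    and lattice_bound: "\<forall>a. 0 < a \<and> a \<le> 1 \<longrightarrow> (\<forall>i j. i \<noteq> j \<longrightarrow>
          trunc2 (P a) i j \<le> c * a powr (1/4)
             * dist (lattice_point a i) (lattice_point a j) powr (-1/4)
             * exp (- m * dist (lattice_point a i) (lattice_point a j)))"
  shows "\<forall>f g. test_fun f \<longrightarrow> test_fun g \<longrightarrow>
          integrable M (\<lambda>\<omega>. (\<Phi> f \<omega>)\<^sup>2) \<and> integrable M (\<lambda>\<omega>. (\<Phi> g \<omega>)\<^sup>2) \<and>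
          \<bar>(\<integral>\<omega>. \<Phi> f \<omega> * \<Phi> g \<omega> \<partial>M) - (\<integral>\<omega>. \<Phi> f \<omega> \<partial>M) * (\<integral>\<omega>. \<Phi> g \<omega> \<partial>M)\<bar>
            \<le> c * (\<integral>x. (\<integral>y. \<bar>f x\<bar> * \<bar>g y\<bar> * dist x y powr (-1/4) * exp (- m * dist x y)
                    \<partial>(lborel :: (real \<times> real) measure)) \<partial>(lborel :: (real \<times> real) measure))"
proof -
  interpret M: prob_space M by (rule M_prob)
  define B where "B f g = c * (\<integral>x. (\<integral>y. \<bar>f x\<bar> * \<bar>g y\<bar> * dist x y powr (-1/4) * exp (- m * dist x y)
                    \<partial>(lborel :: (real \<times> real) measure)) \<partial>(lborel :: (real \<times> real) measure))" for f g
  have clamped: "\<bar>(\<integral>\<omega>. clamp_at N (\<Phi> f \<omega>) * clamp_at N (\<Phi> g \<omega>) \<partial>M)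
      - (\<integral>\<omega>. clamp_at N (\<Phi> f \<omega>) \<partial>M) * (\<integral>\<omega>. clamp_at N (\<Phi> g \<omega>) \<partial>M)\<bar> \<le> B f g"
    if f: "test_fun f" and g: "test_fun g" for f g N
  proof -
    \<comment> \<open>Dominated convergence calls for a sequence; \<open>Suc\<close> keeps a n
      positive, and a n \<le> 1 is the range of the lattice bound.\<close>
    define a :: "nat \<Rightarrow> real" where "a n = 1 / real (Suc n)" for n
    have a: "0 < a n" "a n \<le> 1" for n by (auto simp: a_def)
    have a0: "a \<longlonglongrightarrow> 0" unfolding a_def by (rule LIMSEQ_Suc[OF lim_1_over_n])
    have a_right: "filterlim a (at_right 0) sequentially"
      using a0 a(1) by (intro tendsto_imp_filterlim_at_right) auto
    obtain Rf Rg where Rf: "Rf \<ge> 0" "{x. f x \<noteq> 0} \<subseteq> square Rf" and Rg: "Rg \<ge> 0" "{x. g x \<noteq> 0} \<subseteq> square Rg"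
      using test_fun_support f g by metis
    obtain Cf Cg where Cf: "\<And>x. \<bar>f x\<bar> \<le> Cf" and Cg: "\<And>x. \<bar>g x\<bar> \<le> Cg"
      using test_fun_bounded f g by metis
    define R where "R = max Rf Rg"
    define C where "C = max Cf Cg"
    have R: "R \<ge> 0" "{x. f x \<noteq> 0} \<subseteq> square R" "{x. g x \<noteq> 0} \<subseteq> square R"
      using Rf Rg by (fastforce simp: R_def square_def)+
    have C: "\<bar>f x\<bar> \<le> C" "\<bar>g x\<bar> \<le> C" for x
      using Cf[of x] Cg[of x] by (auto simp: C_def)
    \<comment> \<open>The covariance bound sums over one index set, so both fields are extended to
      the union of their supports by vanishing terms.\<close>
    define I where "I n = {i. f (lattice_point (a n) i) \<noteq> 0} \<union> {i. g (lattice_point (a n) i) \<noteq> 0}" for n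
    have finI: "finite (I n)" for n
      unfolding I_def using finite_lattice_support[OF a(1)] R by blast
    have subI: "{i. f (lattice_point (a n) i) \<noteq> 0} \<subseteq> I n" "{i. g (lattice_point (a n) i) \<noteq> 0} \<subseteq> I n" for n
      by (auto simp: I_def)
    have field: "lattice_field (a n) u \<sigma> = (\<Sum>i\<in>I n. \<sigma> i * (a n powr (15/8) * u (lattice_point (a n) i)))"
      if "{i. u (lattice_point (a n) i) \<noteq> 0} \<subseteq> I n" for u n \<sigma>
      unfolding lattice_field_def sum_distrib_left using that
      by (intro sum.mono_neutral_cong_left finI) auto
    let ?X = "\<lambda>n \<sigma>. clamp_at N (lattice_field (a n) f \<sigma>)"
    let ?Y = "\<lambda>n \<sigma>. clamp_at N (lattice_field (a n) g \<sigma>)"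
    have conv: "(\<lambda>n. \<integral>\<sigma>. F (lattice_field (a n) f \<sigma>, lattice_field (a n) g \<sigma>) \<partial>(P (a n)))
        \<longlonglongrightarrow> (\<integral>\<omega>. F (\<Phi> f \<omega>, \<Phi> g \<omega>) \<partial>M)"
      if "continuous_on UNIV F" "\<And>x. \<bar>F x\<bar> \<le> K" for F and K :: real
    proof -
      have "bounded (range F)" using that(2) by (auto simp: bounded_iff)
      with conv_law f g that(1) show ?thesis
        by (intro filterlim_compose[OF _ a_right]) blast
    qed
    have clamp_mult: "\<bar>clamp_at N s * clamp_at N t\<bar> \<le> real N * real N" for s t
      unfolding abs_mult by (intro mult_mono abs_clamp_at_le) auto
    have cov: "(\<lambda>n. \<bar>(\<integral>\<sigma>. ?X n \<sigma> * ?Y n \<sigma> \<partial>P (a n)) - (\<integral>\<sigma>. ?X n \<sigma> \<partial>P (a n)) * (\<integral>\<sigma>. ?Y n \<sigma> \<partial>P (a n))\<bar>)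
        \<longlonglongrightarrow> \<bar>(\<integral>\<omega>. clamp_at N (\<Phi> f \<omega>) * clamp_at N (\<Phi> g \<omega>) \<partial>M)
          - (\<integral>\<omega>. clamp_at N (\<Phi> f \<omega>) \<partial>M) * (\<integral>\<omega>. clamp_at N (\<Phi> g \<omega>) \<partial>M)\<bar>"
    proof (intro tendsto_rabs tendsto_diff tendsto_mult)
      show "(\<lambda>n. \<integral>\<sigma>. ?X n \<sigma> * ?Y n \<sigma> \<partial>P (a n)) \<longlonglongrightarrow> (\<integral>\<omega>. clamp_at N (\<Phi> f \<omega>) * clamp_at N (\<Phi> g \<omega>) \<partial>M)"
        using conv[of "\<lambda>p. clamp_at N (fst p) * clamp_at N (snd p)", OF _ clamp_mult]
        by (simp add: continuous_intros)
      show "(\<lambda>n. \<integral>\<sigma>. ?X n \<sigma> \<partial>P (a n)) \<longlonglongrightarrow> (\<integral>\<omega>. clamp_at N (\<Phi> f \<omega>) \<partial>M)"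
        using conv[of "\<lambda>p. clamp_at N (fst p)", OF _ abs_clamp_at_le(2)]
        by (simp add: continuous_intros)
      show "(\<lambda>n. \<integral>\<sigma>. ?Y n \<sigma> \<partial>P (a n)) \<longlonglongrightarrow> (\<integral>\<omega>. clamp_at N (\<Phi> g \<omega>) \<partial>M)"
        using conv[of "\<lambda>p. clamp_at N (snd p)", OF _ abs_clamp_at_le(2)]
        by (simp add: continuous_intros)
    qed
    have bound: "\<bar>(\<integral>\<sigma>. ?X n \<sigma> * ?Y n \<sigma> \<partial>P (a n)) - (\<integral>\<sigma>. ?X n \<sigma> \<partial>P (a n)) * (\<integral>\<sigma>. ?Y n \<sigma> \<partial>P (a n))\<bar>
        \<le> a n ^ 4 * (\<Sum>i\<in>I n. \<Sum>j\<in>I n. \<bar>f (lattice_point (a n) i)\<bar> * \<bar>g (lattice_point (a n) j)\<bar>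
            * lattice_kernel c m (a n) i j)" for n
    proof -
      let ?p = "lattice_point (a n)"
      interpret ising "a n powr (15/8) * h" "P (a n)"
        using ising a(1) by unfold_locales auto
      have trunc: "trunc2 (P (a n)) i j \<le> a n powr (1/4) * lattice_kernel c m (a n) i j" for i j
      proof (cases "i = j")
        case True
        have "a n powr (1/4) * a n powr (-1/4) = 1"
          using a(1)[of n] by (simp flip: powr_add)
        then show ?thesis using True trunc2_diag_le[of i] by (simp add: lattice_kernel_def)
      next
        case False
        then show ?thesis
          using lattice_bound[rule_format, of "a n" i j] a[of n] by (simp add: lattice_kernel_def decay_kernel_def mult_ac)
      qed
      have pw: "a n powr (15/8) * a n powr (15/8) * a n powr (1/4) = a n ^ 4"
        using a(1)[of n] powr_realpow[of "a n" 4] by (simp flip: powr_add)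
      have "\<bar>(\<integral>\<sigma>. ?X n \<sigma> * ?Y n \<sigma> \<partial>P (a n)) - (\<integral>\<sigma>. ?X n \<sigma> \<partial>P (a n)) * (\<integral>\<sigma>. ?Y n \<sigma> \<partial>P (a n))\<bar>
        \<le> (\<Sum>i\<in>I n. \<Sum>j\<in>I n. \<bar>a n powr (15/8) * f (?p i)\<bar> * \<bar>a n powr (15/8) * g (?p j)\<bar> * trunc2 (P (a n)) i j)"
        unfolding field[OF subI(1)] field[OF subI(2)]
        by (rule covariance_Lipschitz_le[OF finI clamp_at_Lipschitz clamp_at_measurable])
      also have "\<dots> \<le> (\<Sum>i\<in>I n. \<Sum>j\<in>I n. \<bar>a n powr (15/8) * f (?p i)\<bar> * \<bar>a n powr (15/8) * g (?p j)\<bar>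
            * (a n powr (1/4) * lattice_kernel c m (a n) i j))"
        by (intro sum_mono mult_left_mono trunc) auto
      also have "\<dots> = (\<Sum>i\<in>I n. \<Sum>j\<in>I n. (a n powr (15/8) * a n powr (15/8) * a n powr (1/4))
            * (\<bar>f (?p i)\<bar> * \<bar>g (?p j)\<bar> * lattice_kernel c m (a n) i j))"
        by (simp add: abs_mult mult_ac)
      finally show ?thesis
        unfolding pw sum_distrib_left .
    qed
    have "(\<lambda>n. a n ^ 4 * (\<Sum>i\<in>I n. \<Sum>j\<in>I n. \<bar>f (lattice_point (a n) i)\<bar> * \<bar>g (lattice_point (a n) j)\<bar>
            * lattice_kernel c m (a n) i j)) \<longlonglongrightarrow> B f g"
      unfolding B_def
      by (rule riemann_sum_limit[OF c_pos m_pos R(1) test_fun_continuous[OF f] R(2) C(1)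
            test_fun_continuous[OF g] R(3) C(2) a a0 finI subI])
    from LIMSEQ_le[OF cov this] bound show ?thesis by blast
  qed
  \<comment> \<open>With g = f the clamped covariance bound becomes a variance bound that is uniform
    in N.\<close>
  have sq: "integrable M (\<lambda>\<omega>. (\<Phi> f \<omega>)\<^sup>2)" if f: "test_fun f" for f
  proof (rule M.square_integrable_if_clamp_variance_le)
    show "\<Phi> f \<in> borel_measurable M" using Phi_rv f by blast
    show "(\<integral>\<omega>. (clamp_at N (\<Phi> f \<omega>))\<^sup>2 \<partial>M) - (\<integral>\<omega>. clamp_at N (\<Phi> f \<omega>) \<partial>M)\<^sup>2 \<le> B f f" for N
      using clamped[OF f f, of N] by (simp add: power2_eq_square)
  qed
  have "\<bar>(\<integral>\<omega>. \<Phi> f \<omega> * \<Phi> g \<omega> \<partial>M) - (\<integral>\<omega>. \<Phi> f \<omega> \<partial>M) * (\<integral>\<omega>. \<Phi> g \<omega> \<partial>M)\<bar> \<le> B f g"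
    if "test_fun f" "test_fun g" for f g
    by (rule LIMSEQ_le_const2[OF tendsto_rabs[OF M.covariance_clamp_limit]])
      (use that Phi_rv sq clamped in auto)
  then show ?thesis
    unfolding B_def using sq by blast
qed

end
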